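(* For $i=1,2$ let $0<\eta_i<1$ and $1<\alpha_i<\frac1{\eta_i}$, let $f_i:[0,1]\times[0,+\infty)^4\to[0,+\infty)$ be an $L^\infty$-Carathéodory function and let $g_i\in L^1[0,1]$ be such that $g_i(t)\ge0$ for a.e. $t\in[0,1]$ and $$\int_{\eta_i/\alpha_i}^{\eta_i}\frac{1+\alpha_i}{1-\alpha_i\eta_i}\,s(1-s)g_i(s)\,ds>0,\qquad \int_{\eta_i/\alpha_i}^{\eta_i}\frac{1-s}{1-\alpha_i\eta_i}\,g_i(s)\,ds>0 .$$ Let the constants $c_i$ and the conditions $(\mathrm I^{0}_{\rho_1,\rho_2})$, $(\mathrm I^{1}_{\rho_1,\rho_2})$ be as defined in the context. Then the system $$\begin{cases}-u'''(t)=g_1(t)f_1(t,u(t),u'(t),v(t),v'(t)),\\ -v'''(t)=g_2(t)f_2(t,u(t),u'(t),v(t),v'(t)),\\ u(0)=u'(0)=0,\quad u'(1)=\alpha_1u'(\eta_1),\\ v(0)=v'(0)=0,\quad v'(1)=\alpha_2v'(\eta_2),\end{cases}$$ on $[0,1]$ admits a nontrivial solution with non-negative, non-decreasing components if one of the following conditions holds. $(\hat S_1)$ For $i=1,2$ there exist $\rho_i,r_i\in(0,\infty)$ with $\rho_i/c_i<r_i$ such that $(\mathrm I^{0}_{\rho_1,\rho_2})$ and $(\mathrm I^{1}_{r_1,r_2})$ hold. $(\hat S_2)$ For $i=1,2$ there exist $\rho_i,r_i\in(0,\infty)$ with $\rho_i<r_i$ such that $(\mathrm I^{1}_{\rho_1,\rho_2})$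 and $(\mathrm I^{0}_{r_1,r_2})$ hold.
   Context: $L^\infty$-Carathéodory means: $f_i(\cdot,u_1,u_2,v_1,v_2)$ is measurable for each fixed $(u_1,u_2,v_1,v_2)$, $f_i(t,\cdot,\cdot,\cdot,\cdot)$ is continuous for a.e. $t\in[0,1]$, and for each $r>0$ there is $\varphi_{i,r}\in L^\infty[0,1]$ with $f_i(t,u_1,u_2,v_1,v_2)\le\varphi_{i,r}(t)$ for all $u_1,u_2,v_1,v_2\in[0,r]$ and a.e. $t\in[0,1]$. Associated integral system. The boundary value problem is associated with the system of Hammerstein integral equations, for $(u,v)\in(C^1[0,1])^2$, $$u(t)=\int_0^1k_1(t,s)g_1(s)f_1(s,u(s),u'(s),v(s),v'(s))\,ds,\quad v(t)=\int_0^1k_2(t,s)g_2(s)f_2(s,u(s),u'(s),v(s),v'(s))\,ds,$$ and solutions are understood as solutions of this integral system; here $k_i$ is the Green's function $$k_i(t,s)=\frac1{2(1-\alpha_i\eta_i)}\begin{cases}(2ts-s^2)(1-\alpha_i\eta_i)+t^2s(\alpha_i-1),& s\le\min\{\eta_i,t\},\\ t^2(1-\alpha_i\eta_i)+t^2s(\alpha_i-1),& t\le s\le\eta_i,\\ (2ts-s^2)(1-\alpha_i\eta_i)+t^2(\alpha_i\eta_i-s),&\eta_i\le s\le t,\\ t^2(1-s),&\max\{\eta_i,t\}\le s,\end{cases}$$ with $$\frac{\partial k_i}{\partial t}(t,s)=\frac1{1-\alpha_i\eta_i}\begin{cases}s(1-\alpha_i\eta_i)+ts(\alpha_i-1),&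 s\le\min\{\eta_i,t\},\\ t(1-\alpha_i\eta_i)+ts(\alpha_i-1),& t\le s\le\eta_i,\\ s(1-\alpha_i\eta_i)+t(\alpha_i\eta_i-s),&\eta_i\le s\le t,\\ t(1-s),&\max\{\eta_i,t\}\le s.\end{cases}$$ A solution $(u,v)$ is nontrivial if $\|(u,v)\|:=\max\{\|u\|_{C^1},\|v\|_{C^1}\}\neq0$, where $\|w\|_{C^1}:=\max\{\|w\|_C,\|w'\|_C\}$ and $\|w\|_C:=\max_{t\in[0,1]}|w(t)|$. Constants. For $i=1,2$ put $[a_i,b_i]=[\gamma_i,\delta_i]=[\eta_i/\alpha_i,\eta_i]$, $$c_i=\frac{\eta_i^2}{2\alpha_i^2(1+\alpha_i)}\min\{\alpha_i-1,1\},\qquad d_i=\min\{\alpha_i\eta_i,\eta_i\},$$ $$\frac1{m_i}=\max_{t\in[0,1]}\int_0^1k_i(t,s)g_i(s)\,ds,\qquad \frac1{m_i^*}=\max_{t\in[0,1]}\int_0^1\frac{\partial k_i}{\partial t}(t,s)g_i(s)\,ds,$$ $$\frac1{M_i}=\min_{t\in[a_i,b_i]}\int_{a_i}^{b_i}k_i(t,s)g_i(s)\,ds,\qquad \frac1{M_i^*}=\min_{t\in[\gamma_i,\delta_i]}\int_{\gamma_i}^{\delta_i}\frac{\partial k_i}{\partial t}(t,s)g_i(s)\,ds.$$ Conditions. For $\rho_1,\rho_2>0$: $(\mathrm I^{1}_{\rho_1,\rho_2})$: for $i=1,2$, $f_i^{\rho_1,\rho_2}<\min\{m_i,m_i^*\}$,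 where $$f_i^{\rho_1,\rho_2}:=\sup\Big\{\tfrac{f_i(t,u_1,u_2,v_1,v_2)}{\rho_i}:(t,u_1,u_2,v_1,v_2)\in[0,1]\times[0,\rho_1]^2\times[0,\rho_2]^2\Big\}.$$ $(\mathrm I^{0}_{\rho_1,\rho_2})$: $f_{1,(\rho_1,\rho_2)}>M_1$, $f^*_{1,(\rho_1,\rho_2)}>M_1^*$, $f_{2,(\rho_1,\rho_2)}>M_2$, $f^*_{2,(\rho_1,\rho_2)}>M_2^*$, where $f_{1,(\rho_1,\rho_2)}$ is the infimum of $f_1(t,u_1,u_2,v_1,v_2)/\rho_1$ over $[a_1,b_1]\times[c_1\rho_1,\rho_1]\times[0,\rho_1]\times[0,\rho_2]^2$; $f^*_{1,(\rho_1,\rho_2)}$ is the infimum of $f_1(t,u_1,u_2,v_1,v_2)/\rho_1$ over $[\gamma_1,\delta_1]\times[0,\rho_1]\times[d_1\rho_1,\rho_1]\times[0,\rho_2]^2$; $f_{2,(\rho_1,\rho_2)}$ is the infimum of $f_2(t,u_1,u_2,v_1,v_2)/\rho_2$ over $[a_2,b_2]\times[0,\rho_1]^2\times[c_2\rho_2,\rho_2]\times[0,\rho_2]$; $f^*_{2,(\rho_1,\rho_2)}$ is the infimum of $f_2(t,u_1,u_2,v_1,v_2)/\rho_2$ over $[\gamma_2,\delta_2]\times[0,\rho_1]^2\times[0,\rho_2]\times[d_2\rho_2,\rho_2]$. (In each product the order of the variables is $(t,u_1,u_2,v_1,v_2)$.) *)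

theory Defs
  imports "HOL-Analysis.Analysis"
begin

text \<open>
  Functions on \<open>[0,1]\<close> and on \<open>[0,1] \<times> [0,\<infinity>)\<^sup>4\<close> are total functions on the reals; only their values
  on the stated domain are constrained or used.
\<close>

abbreviation unit_leb :: "real measure" where
  "unit_leb \<equiv> lebesgue_on {0..1}"

definition Linfty :: "(real \<Rightarrow> real) \<Rightarrow> bool" where
  "Linfty \<phi> \<longleftrightarrow> \<phi> \<in> borel_measurable unit_leb \<and> (\<exists>B. AE t in unit_leb. \<bar>\<phi> t\<bar> \<le> B)"

definition Linfty_Caratheodory :: "(real \<Rightarrow> real \<Rightarrow> real \<Rightarrow> real \<Rightarrow> real \<Rightarrow> real) \<Rightarrow> bool" where
  "Linfty_Caratheodory f \<longleftrightarrow>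
     (\<forall>u1\<ge>0. \<forall>u2\<ge>0. \<forall>v1\<ge>0. \<forall>v2\<ge>0. (\<lambda>t. f t u1 u2 v1 v2) \<in> borel_measurable unit_leb) \<and>
     (AE t in unit_leb. continuous_on ({0..} \<times> {0..} \<times> {0..} \<times> {0..})
                          (\<lambda>(u1, u2, v1, v2). f t u1 u2 v1 v2)) \<and>
     (\<forall>r>0. \<exists>\<phi>. Linfty \<phi> \<and>
        (AE t in unit_leb. \<forall>u1\<in>{0..r}. \<forall>u2\<in>{0..r}. \<forall>v1\<in>{0..r}. \<forall>v2\<in>{0..r}.
            f t u1 u2 v1 v2 \<le> \<phi> t))"

text \<open>The case formulas agree where the cases overlap, so the order of the tests is immaterial.\<close>

definition green :: "real \<Rightarrow> real \<Rightarrow> real \<Rightarrow> real \<Rightarrow> real" where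
  "green \<eta> \<alpha> t s = 1 / (2 * (1 - \<alpha> * \<eta>)) *
     (if s \<le> min \<eta> t then (2 * t * s - s^2) * (1 - \<alpha> * \<eta>) + t^2 * s * (\<alpha> - 1)
      else if t \<le> s \<and> s \<le> \<eta> then t^2 * (1 - \<alpha> * \<eta>) + t^2 * s * (\<alpha> - 1)
      else if \<eta> \<le> s \<and> s \<le> t then (2 * t * s - s^2) * (1 - \<alpha> * \<eta>) + t^2 * (\<alpha> * \<eta> - s)
      else t^2 * (1 - s))"

definition green_dt :: "real \<Rightarrow> real \<Rightarrow> real \<Rightarrow> real \<Rightarrow> real" where
  "green_dt \<eta> \<alpha> t s = 1 / (1 - \<alpha> * \<eta>) *
     (if s \<le> min \<eta> t then s * (1 - \<alpha> * \<eta>) + t * s * (\<alpha> - 1)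
      else if t \<le> s \<and> s \<le> \<eta> then t * (1 - \<alpha> * \<eta>) + t * s * (\<alpha> - 1)
      else if \<eta> \<le> s \<and> s \<le> t then s * (1 - \<alpha> * \<eta>) + t * (\<alpha> * \<eta> - s)
      else t * (1 - s))"

text \<open>
  \<open>C\<^sup>1[0,1]\<close> with one-sided derivatives at the end points. (The library predicate
  \<open>C1_differentiable_on\<close> asks for two-sided ones.)
\<close>

definition D :: "(real \<Rightarrow> real) \<Rightarrow> real \<Rightarrow> real" where
  "D u t = vector_derivative u (at t within {0..1})"

definition C1 :: "(real \<Rightarrow> real) \<Rightarrow> bool" where
  "C1 u \<longleftrightarrow> (\<forall>t\<in>{0..1}. u differentiable (at t within {0..1})) \<and> continuous_on {0..1} (D u)"

text \<open>
  For continuous functions on a compact interval the suprema and infima below, and in the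
  constants further down, are the maxima and minima of the usual definitions.
\<close>

definition norm_C :: "(real \<Rightarrow> real) \<Rightarrow> real" where
  "norm_C w = (SUP t\<in>{0..1}. \<bar>w t\<bar>)"

definition norm_C1 :: "(real \<Rightarrow> real) \<Rightarrow> real" where
  "norm_C1 w = max (norm_C w) (norm_C (D w))"

definition norm_pair :: "(real \<Rightarrow> real) \<Rightarrow> (real \<Rightarrow> real) \<Rightarrow> real" where
  "norm_pair u v = max (norm_C1 u) (norm_C1 v)"

text \<open>
  A solution of the boundary value problem is, as usual, a \<open>C\<^sup>1\<close> solution of the associated system
  of Hammerstein integral equations. The sign conditions say that the arguments of the
  nonlinearities stay in their domain; \<open>has_bochner_integral\<close> makes the existence of the
  integrals part of the equations.
\<close>

definition solution ::
  "real \<Rightarrow> real \<Rightarrow> (real \<Rightarrow> real) \<Rightarrow> (real \<Rightarrow> real \<Rightarrow> real \<Rightarrow> real \<Rightarrow> real \<Rightarrow> real) \<Rightarrow>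
   real \<Rightarrow> real \<Rightarrow> (real \<Rightarrow> real) \<Rightarrow> (real \<Rightarrow> real \<Rightarrow> real \<Rightarrow> real \<Rightarrow> real \<Rightarrow> real) \<Rightarrow>
   (real \<Rightarrow> real) \<Rightarrow> (real \<Rightarrow> real) \<Rightarrow> bool" where
  "solution \<eta>1 \<alpha>1 g1 f1 \<eta>2 \<alpha>2 g2 f2 u v \<longleftrightarrow>
     C1 u \<and> C1 v \<and>
     (\<forall>t\<in>{0..1}. 0 \<le> u t \<and> 0 \<le> D u t \<and> 0 \<le> v t \<and> 0 \<le> D v t) \<and>
     (\<forall>t\<in>{0..1}.
        has_bochner_integral unit_leb
          (\<lambda>s. green \<eta>1 \<alpha>1 t s * g1 s * f1 s (u s) (D u s) (v s) (D v s)) (u t) \<and>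
        has_bochner_integral unit_leb
          (\<lambda>s. green \<eta>2 \<alpha>2 t s * g2 s * f2 s (u s) (D u s) (v s) (D v s)) (v t))"

definition c_const :: "real \<Rightarrow> real \<Rightarrow> real" where
  "c_const \<eta> \<alpha> = \<eta>^2 / (2 * \<alpha>^2 * (1 + \<alpha>)) * min (\<alpha> - 1) 1"

definition d_const :: "real \<Rightarrow> real \<Rightarrow> real" where
  "d_const \<eta> \<alpha> = min (\<alpha> * \<eta>) \<eta>"

definition m_const :: "real \<Rightarrow> real \<Rightarrow> (real \<Rightarrow> real) \<Rightarrow> real" where
  "m_const \<eta> \<alpha> g = 1 / (SUP t\<in>{0..1}. LINT s|unit_leb. green \<eta> \<alpha> t s * g s)"

definition m_star :: "real \<Rightarrow> real \<Rightarrow> (real \<Rightarrow> real) \<Rightarrow> real" where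
  "m_star \<eta> \<alpha> g = 1 / (SUP t\<in>{0..1}. LINT s|unit_leb. green_dt \<eta> \<alpha> t s * g s)"

definition M_const :: "real \<Rightarrow> real \<Rightarrow> (real \<Rightarrow> real) \<Rightarrow> real" where
  "M_const \<eta> \<alpha> g =
     1 / (INF t\<in>{\<eta>/\<alpha>..\<eta>}. LINT s|lebesgue_on {\<eta>/\<alpha>..\<eta>}. green \<eta> \<alpha> t s * g s)"

definition M_star :: "real \<Rightarrow> real \<Rightarrow> (real \<Rightarrow> real) \<Rightarrow> real" where
  "M_star \<eta> \<alpha> g =
     1 / (INF t\<in>{\<eta>/\<alpha>..\<eta>}. LINT s|lebesgue_on {\<eta>/\<alpha>..\<eta>}. green_dt \<eta> \<alpha> t s * g s)"

text \<open>
  Extended reals, because a Caratheodory function is bounded only for almost every \<open>t\<close> and the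
  supremum over all \<open>t\<close> may be infinite.
\<close>

definition sup_ratio ::
  "(real \<Rightarrow> real \<Rightarrow> real \<Rightarrow> real \<Rightarrow> real \<Rightarrow> real) \<Rightarrow> real \<Rightarrow>
   (real \<times> real \<times> real \<times> real \<times> real) set \<Rightarrow> ereal" where
  "sup_ratio f \<rho> X = (SUP (t, u1, u2, v1, v2)\<in>X. ereal (f t u1 u2 v1 v2 / \<rho>))"

definition inf_ratio ::
  "(real \<Rightarrow> real \<Rightarrow> real \<Rightarrow> real \<Rightarrow> real \<Rightarrow> real) \<Rightarrow> real \<Rightarrow>
   (real \<times> real \<times> real \<times> real \<times> real) set \<Rightarrow> ereal" where
  "inf_ratio f \<rho> X = (INF (t, u1, u2, v1, v2)\<in>X. ereal (f t u1 u2 v1 v2 / \<rho>))"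

definition cond_I1 ::
  "real \<Rightarrow> real \<Rightarrow> (real \<Rightarrow> real) \<Rightarrow> (real \<Rightarrow> real \<Rightarrow> real \<Rightarrow> real \<Rightarrow> real \<Rightarrow> real) \<Rightarrow>
   real \<Rightarrow> real \<Rightarrow> (real \<Rightarrow> real) \<Rightarrow> (real \<Rightarrow> real \<Rightarrow> real \<Rightarrow> real \<Rightarrow> real \<Rightarrow> real) \<Rightarrow>
   real \<Rightarrow> real \<Rightarrow> bool" where
  "cond_I1 \<eta>1 \<alpha>1 g1 f1 \<eta>2 \<alpha>2 g2 f2 \<rho>1 \<rho>2 \<longleftrightarrow>
     sup_ratio f1 \<rho>1 ({0..1} \<times> {0..\<rho>1} \<times> {0..\<rho>1} \<times> {0..\<rho>2} \<times> {0..\<rho>2})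
       < ereal (min (m_const \<eta>1 \<alpha>1 g1) (m_star \<eta>1 \<alpha>1 g1)) \<and>
     sup_ratio f2 \<rho>2 ({0..1} \<times> {0..\<rho>1} \<times> {0..\<rho>1} \<times> {0..\<rho>2} \<times> {0..\<rho>2})
       < ereal (min (m_const \<eta>2 \<alpha>2 g2) (m_star \<eta>2 \<alpha>2 g2))"

definition cond_I0 ::
  "real \<Rightarrow> real \<Rightarrow> (real \<Rightarrow> real) \<Rightarrow> (real \<Rightarrow> real \<Rightarrow> real \<Rightarrow> real \<Rightarrow> real \<Rightarrow> real) \<Rightarrow>
   real \<Rightarrow> real \<Rightarrow> (real \<Rightarrow> real) \<Rightarrow> (real \<Rightarrow> real \<Rightarrow> real \<Rightarrow> real \<Rightarrow> real \<Rightarrow> real) \<Rightarrow>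
   real \<Rightarrow> real \<Rightarrow> bool" where
  "cond_I0 \<eta>1 \<alpha>1 g1 f1 \<eta>2 \<alpha>2 g2 f2 \<rho>1 \<rho>2 \<longleftrightarrow>
     inf_ratio f1 \<rho>1
         ({\<eta>1/\<alpha>1..\<eta>1} \<times> {c_const \<eta>1 \<alpha>1 * \<rho>1..\<rho>1} \<times> {0..\<rho>1} \<times> {0..\<rho>2} \<times> {0..\<rho>2})
       > ereal (M_const \<eta>1 \<alpha>1 g1) \<and>
     inf_ratio f1 \<rho>1
         ({\<eta>1/\<alpha>1..\<eta>1} \<times> {0..\<rho>1} \<times> {d_const \<eta>1 \<alpha>1 * \<rho>1..\<rho>1} \<times> {0..\<rho>2} \<times> {0..\<rho>2})
       > ereal (M_star \<eta>1 \<alpha>1 g1) \<and>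
     inf_ratio f2 \<rho>2
         ({\<eta>2/\<alpha>2..\<eta>2} \<times> {0..\<rho>1} \<times> {0..\<rho>1} \<times> {c_const \<eta>2 \<alpha>2 * \<rho>2..\<rho>2} \<times> {0..\<rho>2})
       > ereal (M_const \<eta>2 \<alpha>2 g2) \<and>
     inf_ratio f2 \<rho>2
         ({\<eta>2/\<alpha>2..\<eta>2} \<times> {0..\<rho>1} \<times> {0..\<rho>1} \<times> {0..\<rho>2} \<times> {d_const \<eta>2 \<alpha>2 * \<rho>2..\<rho>2})
       > ereal (M_star \<eta>2 \<alpha>2 g2)"

end

theory Submission
  imports Defs "HOL-Complex_Analysis.Great_Picard"
begin

text \<open>
Differentiating the two integral equations in \<open>t\<close> turns them into a fixed point problem for the slopes
\<open>x = u'\<close> and \<open>y = v'\<close>. The kernel \<open>green\<close> vanishes at \<open>t = 0\<close> and is the primitive in \<open>t\<close> of \<open>green_dt\<close>,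
so \<open>u\<close> is recovered from \<open>x\<close> by integration, and \<open>x \<ge> 0\<close> makes \<open>u\<close> nonnegative and nondecreasing.
The operator on slopes has the kernel \<open>green_dt\<close>, which is the Green's function of the three-point problem
\<open>-w'' = h\<close>, \<open>w 0 = 0\<close>, \<open>w 1 = \<alpha> * w \<eta>\<close>. Three properties of this operator carry the proof.

\<^item> Its values lie in the cone of all \<open>w \<ge> 0\<close> with \<open>w t \<ge> min t \<eta> * sup w\<close> (\<open>green_dt_cone\<close>).
\<^item> By the upper bound on the nonlinearities (\<open>cond_I1\<close>), it maps the box of slopes with \<open>x \<le> \<rho>1\<close>, \<open>y \<le> \<rho>2\<close>
  into a strictly smaller box (\<open>slope_op_contracts_box\<close>).
\<^item> By the lower bound (\<open>cond_I0\<close>), it enlarges a component \<open>x\<close> in the cone whose supremum equals the side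
  \<open>\<rho>\<close> of the box: the cone inequality gives \<open>u s \<ge> (\<eta>/\<alpha>)\<^sup>2 / 2 * \<rho> \<ge> c * \<rho>\<close> on \<open>[\<eta>/\<alpha>, \<eta>]\<close>, the
  nonlinearity is large there, and the primitive of the image exceeds \<open>\<rho>\<close> at \<open>\<eta>/\<alpha>\<close>; so the image itself
  exceeds \<open>\<rho>\<close> somewhere (\<open>slope_op_leaves_box\<close>).

The usual conclusion compares the fixed point indices on the two boxes. Here one application of Schauder's
theorem suffices. Let the sides of a box move linearly with \<open>\<tau> \<in> [0,1]\<close> from the box where \<open>cond_I1\<close> holds to
the box where \<open>cond_I0\<close> holds, and write a pair of slopes as a shape, of supremum norm \<open>1\<close>, scaled by the
sides at \<open>\<tau>\<close>. The shapes of norm \<open>1\<close> do not form a convex set, so all shapes of norm at most \<open>1\<close> are admitted and first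
moved to norm \<open>1\<close> inside the cone (\<open>push\<close>). A continuous map sends \<open>(shape, \<tau>)\<close> to the shape of the image and to \<open>\<tau> + 1 - p\<close>, where \<open>p\<close> is
the norm of the rescaled image; values above \<open>1\<close>, and values of \<open>\<tau>\<close> outside \<open>[0,1]\<close>, are truncated. At a fixed point \<open>\<tau> = 0\<close> would need
\<open>p \<ge> 1\<close>, against the contraction, and \<open>\<tau> = 1\<close> would need \<open>p \<le> 1\<close>, against the expansion. Hence \<open>p = 1\<close>,
the truncations do nothing, and the scaled shape is a fixed point of the slope operators of norm \<open>1\<close> relative to
its box, hence nonzero (\<open>nontrivial_fixed_point\<close>). The two alternatives of the hypothesis differ in which of the two
conditions belongs to the smaller box; the argument is the same for both.

Schauder's theorem is derived from Kuhn's combinatorial lemma. In that lemma the dimension is a natural number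
and not a type, as it has to be because the number of points in a Schauder projection is not known beforehand.
\<close>

section \<open>Schauder's fixed point theorem\<close>

definition hilbert_cube :: "(nat \<Rightarrow> real) set" where
  "hilbert_cube = {x. \<forall>i. x i \<in> {0..1}}"

lemma compact_hilbert_cube: "compact hilbert_cube"
proof -
  have "hilbert_cube = (\<Pi>\<^sub>E i\<in>UNIV. {0..1})"
    by (auto simp: hilbert_cube_def)
  moreover have "compactin (product_topology (\<lambda>i::nat. euclidean :: real topology) UNIV) (\<Pi>\<^sub>E i\<in>UNIV. {0..1})"
    by (subst compactin_PiE) auto
  ultimately show ?thesis
    by (simp add: euclidean_product_topology)
qed

text \<open>
Convergence in the product topology; the limits of lattice points below are taken in this sense.
\<close>

lemma tendsto_fun_coordinatewise:
  fixes f :: "nat \<Rightarrow> 'a \<Rightarrow> 'b::topological_space"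
  shows "(f \<longlonglongrightarrow> l) \<longleftrightarrow> (\<forall>i. (\<lambda>n. f n i) \<longlonglongrightarrow> l i)"
  using limitin_componentwise[of "\<lambda>_. euclidean" UNIV f l sequentially]
  by (simp add: euclidean_product_topology)

text \<open>
Brouwer's theorem for the cube of dimension \<open>n\<close>, where the cube consists of the first \<open>n\<close> coordinates of the Hilbert
cube. A lattice point is labelled according to the direction in which \<open>F\<close> moves its \<open>i\<close>-th coordinate. Kuhn's lemma
finds small lattice cells in which, for every \<open>i\<close>, both directions occur at some corner; in the limit of such
cells the \<open>i\<close>-th coordinate moves in neither direction.
\<close>

lemma brouwer_finitely_many_coordinates:
  fixes F :: "(nat \<Rightarrow> real) \<Rightarrow> nat \<Rightarrow> real"
  assumes cont: "\<And>i. i < n \<Longrightarrow> continuous_on hilbert_cube (\<lambda>x. F x i)"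
    and range: "\<And>x i. x \<in> hilbert_cube \<Longrightarrow> i < n \<Longrightarrow> F x i \<in> {0..1}"
  obtains x where "x \<in> hilbert_cube" "\<And>i. i < n \<Longrightarrow> F x i = x i"
proof -
  define pt where "pt p q = (\<lambda>i. if i < n then real (q i) / real p else 0)" for p and q :: "nat \<Rightarrow> nat"
  define near where "near p q r \<longleftrightarrow> (\<forall>j<n. q j \<le> r j \<and> r j \<le> q j + 1 \<and> r j \<le> p)"
    for p :: nat and q r :: "nat \<Rightarrow> nat"
  have pt_cube: "pt p q \<in> hilbert_cube" if "\<forall>i<n. q i \<le> p" for p q
    using that by (auto simp: pt_def hilbert_cube_def divide_le_eq_1)
  have kuhn: "\<exists>q. (\<forall>i<n. q i < p) \<and> (\<forall>i<n. \<exists>r s. near p q r \<and> near p q s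
                 \<and> pt p r i \<le> F (pt p r) i \<and> F (pt p s) i \<le> pt p s i)" if "p > 0" for p
  proof -
    \<comment> \<open>On the boundary of the cube the label is prescribed; there it agrees with the direction of \<open>F\<close> because \<open>F\<close> maps into the cube.\<close>
    define label where "label q i = (if q i = 0 then 0 else if q i = p then 1
        else if pt p q i \<le> F (pt p q) i then 0 else 1 :: nat)" for q i
    have label01: "label q i = 0 \<or> label q i = 1" for q i
      by (simp add: label_def)
    have l0: "pt p q i \<le> F (pt p q) i" if "label q i = 0" "i < n" "\<forall>i<n. q i \<le> p" for q i
    proof (cases "q i = 0")
      case True
      with range[OF pt_cube[OF that(3)] that(2)] show ?thesis
        by (simp add: pt_def)
    next
      case False
      with that(1) show ?thesis
        by (simp add: label_def split: if_split_asm)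
    qed
    have l1: "F (pt p q) i \<le> pt p q i" if "label q i = 1" "i < n" "\<forall>i<n. q i \<le> p" for q i
    proof (cases "q i = p")
      case True
      with range[OF pt_cube[OF that(3)] that(2)] that(2) \<open>p > 0\<close> show ?thesis
        by (simp add: pt_def)
    next
      case False
      with that(1) show ?thesis
        by (simp add: label_def split: if_split_asm)
    qed
    have "\<forall>x. (\<forall>i<n. x i \<le> p) \<longrightarrow> (\<forall>i<n. label x i = (0::nat) \<or> label x i = 1)"
         "\<forall>x. (\<forall>i<n. x i \<le> p) \<longrightarrow> (\<forall>i<n. x i = 0 \<longrightarrow> label x i = 0)"
         "\<forall>x. (\<forall>i<n. x i \<le> p) \<longrightarrow> (\<forall>i<n. x i = p \<longrightarrow> label x i = 1)"
      using \<open>p > 0\<close> by (auto simp: label_def)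
    from kuhn_lemma[OF \<open>p > 0\<close> this] obtain q where q: "\<forall>i<n. q i < p"
      and rs: "\<forall>i<n. \<exists>r s. (\<forall>j<n. q j \<le> r j \<and> r j \<le> q j + 1) \<and>
            (\<forall>j<n. q j \<le> s j \<and> s j \<le> q j + 1) \<and> label r i \<noteq> label s i"
      by metis
    have "\<exists>r s. near p q r \<and> near p q s \<and> pt p r i \<le> F (pt p r) i \<and> F (pt p s) i \<le> pt p s i"
      if i: "i < n" for i
    proof -
      from rs i obtain r s where r: "\<forall>j<n. q j \<le> r j \<and> r j \<le> q j + 1"
        and s: "\<forall>j<n. q j \<le> s j \<and> s j \<le> q j + 1" and ne: "label r i \<noteq> label s i"
        by metis
      have nr: "near p q r" and ns: "near p q s"
        using r s q by (force simp: near_def)+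
      then have bd: "\<forall>i<n. r i \<le> p" "\<forall>i<n. s i \<le> p"
        by (auto simp: near_def)
      have "label r i = 0 \<and> label s i = 1 \<or> label r i = 1 \<and> label s i = 0"
        using ne label01 by metis
      then show ?thesis
          using l0 l1 bd i nr ns by metis
    qed
    then show ?thesis using q by blast
  qed
  define good where "good k q i r s \<longleftrightarrow> near (Suc k) q r \<and> near (Suc k) q s
      \<and> pt (Suc k) r i \<le> F (pt (Suc k) r) i \<and> F (pt (Suc k) s) i \<le> pt (Suc k) s i" for k q i r s
  have "\<forall>k. \<exists>q. (\<forall>i<n. q i < Suc k) \<and> (\<forall>i<n. \<exists>r s. good k q i r s)"
    unfolding good_def using kuhn by simp
  then obtain q where q1: "\<And>k i. i < n \<Longrightarrow> q k i < Suc k"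
    and q2: "\<And>k i. i < n \<Longrightarrow> \<exists>r s. good k (q k) i r s"
    by metis
  define z where "z k i = (SOME z. good k (q k) i (fst z) (snd z))" for k i
  define r s where "r k i = fst (z k i)" and "s k i = snd (z k i)" for k i
  have "good k (q k) i (r k i) (s k i)" if "i < n" for k i
  proof -
    have "\<exists>z. good k (q k) i (fst z) (snd z)"
      using q2[OF that, of k] by (metis fst_conv snd_conv)
    then show ?thesis
      unfolding r_def s_def z_def by (rule someI_ex)
  qed
  then have nr: "\<And>k i. i < n \<Longrightarrow> near (Suc k) (q k) (r k i)"
    and ns: "\<And>k i. i < n \<Longrightarrow> near (Suc k) (q k) (s k i)"
    and Fr: "\<And>k i. i < n \<Longrightarrow> pt (Suc k) (r k i) i \<le> F (pt (Suc k) (r k i)) i"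
    and Fs: "\<And>k i. i < n \<Longrightarrow> F (pt (Suc k) (s k i)) i \<le> pt (Suc k) (s k i) i"
    by (auto simp: good_def)
  have "\<forall>k. pt (Suc k) (q k) \<in> hilbert_cube"
    using q1 by (intro allI pt_cube) (auto intro: less_imp_le)
  with compact_imp_seq_compact[OF compact_hilbert_cube]
  obtain x \<sigma> where x: "x \<in> hilbert_cube" and \<sigma>: "strict_mono (\<sigma> :: nat \<Rightarrow> nat)"
    and lim: "((\<lambda>k. pt (Suc k) (q k)) \<circ> \<sigma>) \<longlonglongrightarrow> x"
    unfolding seq_compact_def by metis
  \<comment> \<open>Every choice of lattice points next to \<open>q\<close> has the same limit.\<close>
  have lim_near: "(\<lambda>k. pt (Suc (\<sigma> k)) (h (\<sigma> k))) \<longlonglongrightarrow> x"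
    if h: "\<And>k. near (Suc k) (q k) (h k)" for h
    unfolding tendsto_fun_coordinatewise
  proof
    fix j
    have lj: "(\<lambda>k. pt (Suc (\<sigma> k)) (q (\<sigma> k)) j) \<longlonglongrightarrow> x j"
      using lim by (simp add: tendsto_fun_coordinatewise o_def)
    have "\<bar>pt (Suc k) (h k) j - pt (Suc k) (q k) j\<bar> \<le> inverse (real (Suc k))" for k
    proof (cases "j < n")
      case True
      have "pt (Suc k) (h k) j - pt (Suc k) (q k) j = (real (h k j) - real (q k j)) / real (Suc k)"
        using True by (simp add: pt_def diff_divide_distrib)
      moreover have "\<bar>real (h k j) - real (q k j)\<bar> \<le> 1"
        using h[of k] True by (force simp: near_def)
      ultimately show ?thesis
        by (simp add: abs_divide divide_right_mono inverse_eq_divide del: of_nat_Suc)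
    qed (simp add: pt_def)
    then have "(\<lambda>k. pt (Suc k) (h k) j - pt (Suc k) (q k) j) \<longlonglongrightarrow> 0"
      by (intro tendsto_rabs_zero_cancel[OF tendsto_sandwich[OF _ _ tendsto_const LIMSEQ_inverse_real_of_nat]])
         (auto intro!: always_eventually)
    from tendsto_add[OF LIMSEQ_subseq_LIMSEQ[OF this \<sigma>] lj]
    show "(\<lambda>k. pt (Suc (\<sigma> k)) (h (\<sigma> k)) j) \<longlonglongrightarrow> x j"
      by (simp add: o_def)
  qed
  have "F x i = x i" if i: "i < n" for i
  proof -
    have F_lim: "(\<lambda>k. F (pt (Suc (\<sigma> k)) (h (\<sigma> k))) i) \<longlonglongrightarrow> F x i"
      if h: "\<And>k. near (Suc k) (q k) (h k)" for h
    proof (rule continuous_on_tendsto_compose[OF cont[OF i] lim_near[OF h] x])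
      show "\<forall>\<^sub>F k in sequentially. pt (Suc (\<sigma> k)) (h (\<sigma> k)) \<in> hilbert_cube"
        using h by (intro always_eventually allI pt_cube) (auto simp: near_def)
    qed
    have p_lim: "(\<lambda>k. pt (Suc (\<sigma> k)) (h (\<sigma> k)) i) \<longlonglongrightarrow> x i"
      if h: "\<And>k. near (Suc k) (q k) (h k)" for h
      using lim_near[OF h] by (simp add: tendsto_fun_coordinatewise)
    have "x i \<le> F x i"
      using Fr i by (intro LIMSEQ_le[OF p_lim F_lim, of "\<lambda>k. r k i" "\<lambda>k. r k i"] nr) auto
    moreover have "F x i \<le> x i"
      using Fs i by (intro LIMSEQ_le[OF F_lim p_lim, of "\<lambda>k. s k i" "\<lambda>k. s k i"] ns) auto
    ultimately show ?thesis by simp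
  qed
  with x that show thesis by blast
qed

text \<open>
A compact set is moved by at most \<open>e\<close> into the convex hull of finitely many of its points. The weight of a
centre \<open>c j\<close> is proportional to \<open>max 0 (e - dist (c j) y)\<close>, so only centres closer to \<open>y\<close> than \<open>e\<close> contribute.
\<close>

lemma schauder_projection:
  fixes K :: "'a::real_normed_vector set"
  assumes "compact K" "K \<noteq> {}" "e > 0"
  obtains m :: nat and c l where "m > 0" "\<And>j. j < m \<Longrightarrow> c j \<in> K"
    "\<And>j. j < m \<Longrightarrow> continuous_on K (l j)" "\<And>j y. j < m \<Longrightarrow> y \<in> K \<Longrightarrow> 0 \<le> l j y"
    "\<And>y. y \<in> K \<Longrightarrow> (\<Sum>j<m. l j y) = 1"
    "\<And>y. y \<in> K \<Longrightarrow> norm ((\<Sum>j<m. l j y *\<^sub>R c j) - y) \<le> e" 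
proof -
  obtain C where C: "finite C" "C \<subseteq> K" "K \<subseteq> (\<Union>x\<in>C. ball x e)"
    using compact_imp_seq_compact[OF assms(1)] seq_compact_imp_totally_bounded assms(3) by metis
  obtain c m where cm: "C = c ` {i::nat. i < m}"
    using finite_imp_nat_seg_image_inj_on[OF C(1)] by metis
  have m: "m > 0"
    using C(3) assms(2) cm by (cases m) auto
  define w where "w j y = max 0 (e - dist (c j) y)" for j y
  define W where "W y = (\<Sum>j<m. w j y)" for y
  have w_nonneg: "0 \<le> w j y" for j y
    by (simp add: w_def)
  have W_pos: "W y > 0" if y: "y \<in> K" for y
  proof -
    obtain x where "x \<in> C" "y \<in> ball x e"
      using subsetD[OF C(3) y] by blast
    then obtain j where "j < m" "dist (c j) y < e"
      unfolding cm by auto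
    then show ?thesis
      unfolding W_def by (intro sum_pos2[of _ j]) (auto simp: w_def)
  qed
  have W1: "(\<Sum>j<m. w j y / W y) = 1" if "y \<in> K" for y
    using W_pos[OF that] by (simp add: sum_divide_distrib[symmetric] W_def)
  show thesis
  proof (rule that[of m c "\<lambda>j y. w j y / W y"])
    show "c j \<in> K" if "j < m" for j
      using that C(2) cm by auto
    show "continuous_on K (\<lambda>y. w j y / W y)" for j
    proof (rule continuous_on_divide)
      show "continuous_on K (w j)" "continuous_on K W"
        unfolding w_def W_def by (intro continuous_intros)+
      show "\<forall>y\<in>K. W y \<noteq> 0"
        using W_pos by force
    qed
    show "0 \<le> w j y / W y" if "y \<in> K" for j y
      using W_pos[OF that] w_nonneg by (simp add: divide_nonneg_pos)
    show "norm ((\<Sum>j<m. (w j y / W y) *\<^sub>R c j) - y) \<le> e" if y: "y \<in> K" for y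
    proof -
      have "(\<Sum>j<m. (w j y / W y) *\<^sub>R c j) - y = (\<Sum>j<m. (w j y / W y) *\<^sub>R (c j - y))"
        using W1[OF y] by (simp add: scaleR_diff_right sum_subtractf scaleR_left.sum[symmetric])
      also have "norm \<dots> \<le> (\<Sum>j<m. (w j y / W y) * e)"
      proof (rule sum_norm_le)
        fix j assume "j \<in> {..<m}"
        have "w j y * norm (c j - y) \<le> w j y * e"
          by (auto simp: w_def dist_norm max_def intro!: mult_left_mono)
        then show "norm ((w j y / W y) *\<^sub>R (c j - y)) \<le> (w j y / W y) * e"
          using W_pos[OF y] w_nonneg[of j y] by (simp add: divide_right_mono)
      qed
      also have "\<dots> = e"
        using W1[OF y] by (simp only: sum_distrib_right[symmetric] mult_1)
      finally show ?thesis .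
    qed
  qed (use m W1 in auto)
qed

text \<open>
For each \<open>e > 0\<close> the Schauder projection reduces the problem to the weights \<open>q j\<close> of finitely many points, where
Brouwer's theorem gives a point that \<open>F\<close> moves by at most \<open>e\<close>. Compactness of \<open>K\<close> gives a limit point of these approximate fixed points.
\<close>

theorem schauder_fixed_point:
  fixes S :: "'a::real_normed_vector set"
  assumes "convex S" "S \<noteq> {}" and cont: "continuous_on S F" and FK: "\<And>x. x \<in> S \<Longrightarrow> F x \<in> K"
    and K: "compact K" "K \<subseteq> S"
  obtains x where "x \<in> S" "F x = x"
proof -
  have approx: "\<exists>x\<in>S. norm (x - F x) \<le> e" if "e > 0" for e
  proof -
    have "K \<noteq> {}"
      using assms(2) FK by blast
    then obtain m :: nat and c l where m: "m > 0" and cK: "\<And>j. j < m \<Longrightarrow> c j \<in> K"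
      and lc: "\<And>j. j < m \<Longrightarrow> continuous_on K (l j)" and l0: "\<And>j y. j < m \<Longrightarrow> y \<in> K \<Longrightarrow> 0 \<le> l j y"
      and l1: "\<And>y. y \<in> K \<Longrightarrow> (\<Sum>j<m. l j y) = 1"
      and le: "\<And>y. y \<in> K \<Longrightarrow> norm ((\<Sum>j<m. l j y *\<^sub>R c j) - y) \<le> e"
      using schauder_projection[OF K(1) _ \<open>e > 0\<close>] by blast
    \<comment> \<open>A retraction of the cube onto the simplex of weights: mass is added evenly if the sum is below \<open>1\<close>, and divided out if it is above.\<close>
    define r where "r q j = (q j + max 0 (1 - (\<Sum>i<m. q i)) / real m) / max 1 (\<Sum>i<m. q i)"
      for q :: "nat \<Rightarrow> real" and j
    have r0: "0 \<le> r q j" if "q \<in> hilbert_cube" for q j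
      using that by (auto simp: r_def hilbert_cube_def intro!: divide_nonneg_pos add_nonneg_nonneg)
    have r1: "(\<Sum>j<m. r q j) = 1" for q
    proof -
      have "(\<Sum>j<m. r q j) = (\<Sum>j<m. q j + max 0 (1 - (\<Sum>i<m. q i)) / real m) / max 1 (\<Sum>i<m. q i)"
        unfolding r_def by (rule sum_divide_distrib[symmetric])
      also have "\<dots> = ((\<Sum>j<m. q j) + max 0 (1 - (\<Sum>i<m. q i))) / max 1 (\<Sum>i<m. q i)"
        using m by (simp add: sum.distrib)
      also have "\<dots> = 1"
        by (auto simp: max_def)
      finally show ?thesis .
    qed
    have r_id: "r q j = q j" if "(\<Sum>i<m. q i) = 1" for q j
      using that by (simp add: r_def)
    define p where "p q = (\<Sum>j<m. r q j *\<^sub>R c j)" for q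
    have p_in: "p q \<in> S" if "q \<in> hilbert_cube" for q
      unfolding p_def using that r0 r1 cK K(2) by (intro convex_sum[OF _ \<open>convex S\<close>]) auto
    have p_cont: "continuous_on hilbert_cube p"
      unfolding p_def r_def
      by (intro continuous_intros ballI continuous_on_subset[OF continuous_on_product_coordinates]) auto
    have Fp_cont: "continuous_on hilbert_cube (\<lambda>q. F (p q))"
      using p_in by (intro continuous_on_compose2[OF cont p_cont]) auto
    obtain q where q: "q \<in> hilbert_cube" "\<And>j. j < m \<Longrightarrow> l j (F (p q)) = q j"
    proof (rule brouwer_finitely_many_coordinates[of m "\<lambda>q j. l j (F (p q))"])
      show "continuous_on hilbert_cube (\<lambda>q. l j (F (p q)))" if "j < m" for j
        using p_in FK by (intro continuous_on_compose2[OF lc[OF that] Fp_cont]) auto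
      show "l j (F (p q)) \<in> {0..1}" if "q \<in> hilbert_cube" "j < m" for q j
      proof -
        have y: "F (p q) \<in> K"
          using that p_in FK by blast
        have "l j (F (p q)) \<le> (\<Sum>j<m. l j (F (p q)))"
          using l0 y that by (intro member_le_sum) auto
        then show ?thesis
          using l0 l1 y that by auto
      qed
    qed blast
    have y: "F (p q) \<in> K"
      using q p_in FK by blast
    have "(\<Sum>i<m. q i) = 1"
      using l1[OF y] q(2) by simp
    then have "p q = (\<Sum>j<m. l j (F (p q)) *\<^sub>R c j)"
      by (subst p_def) (simp add: r_id q(2))
    then show ?thesis
      using le[OF y] p_in[OF q(1)] by metis
  qed
  have "\<exists>x. \<forall>k. x k \<in> S \<and> norm (x k - F (x k)) \<le> inverse (real (Suc k))"
    using approx by (intro choice allI) (metis inverse_positive_iff_positive of_nat_0_less_iff zero_less_Suc)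
  then obtain x where x: "\<And>k. x k \<in> S" "\<And>k. norm (x k - F (x k)) \<le> inverse (real (Suc k))"
    by blast
  obtain y \<sigma> where y: "y \<in> K" and \<sigma>: "strict_mono (\<sigma> :: nat \<Rightarrow> nat)"
    and lim: "((\<lambda>k. F (x k)) \<circ> \<sigma>) \<longlonglongrightarrow> y"
    using compact_imp_seq_compact[OF K(1)] x(1) FK unfolding seq_compact_def by metis
  have "(\<lambda>k. x k - F (x k)) \<longlonglongrightarrow> 0"
    by (rule Lim_null_comparison[OF _ LIMSEQ_inverse_real_of_nat]) (use x(2) in auto)
  from tendsto_add[OF LIMSEQ_subseq_LIMSEQ[OF this \<sigma>] lim]
  have xlim: "(\<lambda>k. x (\<sigma> k)) \<longlonglongrightarrow> y"
    by (simp add: o_def)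
  have "(\<lambda>k. F (x (\<sigma> k))) \<longlonglongrightarrow> F y"
    using y K(2) x(1) by (intro continuous_on_tendsto_compose[OF cont xlim]) auto
  with lim have "F y = y"
    by (simp add: o_def LIMSEQ_unique)
  with y K(2) that show thesis by blast
qed

section \<open>The Green's function of the three-point problem\<close>

text \<open>
The kernel of the problem \<open>-w'' = h\<close>, \<open>w 0 = 0\<close>, \<open>w' 1 = 0\<close> is \<open>min s t\<close>. The three-point condition
\<open>w 1 = \<alpha> * w \<eta>\<close> is met by adding the solution \<open>t * tilt \<eta> \<alpha> s\<close> of the homogeneous equation.
\<close>

definition tilt :: "real \<Rightarrow> real \<Rightarrow> real \<Rightarrow> real" where
  "tilt \<eta> \<alpha> s = (if s \<le> \<eta> then s * (\<alpha> - 1) else \<alpha> * \<eta> - s) / (1 - \<alpha> * \<eta>)"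

locale three_point =
  fixes \<eta> \<alpha> :: real
  assumes eta_pos: "0 < \<eta>" and eta_less_1: "\<eta> < 1" and alpha_gt_1: "1 < \<alpha>"
    and alpha_eta_less_1: "\<alpha> * \<eta> < 1"
begin

text \<open>
The four cases of the kernels collapse to these closed forms, from which all estimates are read off.
\<close>

lemma green_dt_eq: "green_dt \<eta> \<alpha> t s = min s t + t * tilt \<eta> \<alpha> s"
  using alpha_eta_less_1
  by (auto simp: green_dt_def tilt_def min_def field_simps)

lemma green_eq: "green \<eta> \<alpha> t s = (t\<^sup>2 - (max 0 (t - s))\<^sup>2 + t\<^sup>2 * tilt \<eta> \<alpha> s) / 2"
proof -
  define e where "e = 1 - \<alpha> * \<eta>"
  have e: "e > 0" "\<alpha> * \<eta> = 1 - e"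
    using alpha_eta_less_1 by (auto simp: e_def)
  have *: "t\<^sup>2 - (max 0 (t - s))\<^sup>2 = (if s \<le> t then 2 * t * s - s\<^sup>2 else t\<^sup>2)"
    by (auto simp: max_def power2_eq_square algebra_simps)
  consider "s \<le> \<eta>" "s \<le> t" | "s \<le> \<eta>" "t < s" | "\<eta> < s" "s \<le> t" | "\<eta> < s" "t < s"
    by linarith
  then show ?thesis
    unfolding *
    by cases (use e in \<open>simp_all add: green_def tilt_def min_def e(2) power2_eq_square field_simps\<close>)
qed

definition kernel_bound :: real where
  "kernel_bound = 1 + \<alpha> / (1 - \<alpha> * \<eta>)"

lemma kernel_bound_pos: "kernel_bound > 0"
  using alpha_gt_1 alpha_eta_less_1 by (simp add: kernel_bound_def add_pos_pos)

lemma abs_tilt_le: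
  assumes "s \<in> {0..1}"
  shows "\<bar>tilt \<eta> \<alpha> s\<bar> \<le> kernel_bound - 1"
proof -
  have "\<bar>if s \<le> \<eta> then s * (\<alpha> - 1) else \<alpha> * \<eta> - s\<bar> \<le> \<alpha>"
  proof (cases "s \<le> \<eta>")
    case True
    have "s * (\<alpha> - 1) \<le> 1 * \<alpha>"
      using assms alpha_gt_1 by (intro mult_mono) auto
    with True show ?thesis
      using assms alpha_gt_1 by simp
  next
    case False
    have "0 < \<alpha> * \<eta>"
      using alpha_gt_1 eta_pos by simp
    with False show ?thesis
      using assms alpha_gt_1 alpha_eta_less_1 by (auto simp: abs_le_iff)
  qed
  then show ?thesis
    using alpha_eta_less_1 by (simp add: tilt_def kernel_bound_def abs_divide divide_right_mono)
qed

lemma green_dt_lipschitz: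
  assumes "s \<in> {0..1}"
  shows "\<bar>green_dt \<eta> \<alpha> t s - green_dt \<eta> \<alpha> t' s\<bar> \<le> kernel_bound * \<bar>t - t'\<bar>"
proof -
  have "green_dt \<eta> \<alpha> t s - green_dt \<eta> \<alpha> t' s = (min s t - min s t') + (t - t') * tilt \<eta> \<alpha> s"
    by (simp add: green_dt_eq algebra_simps)
  also have "\<bar>\<dots>\<bar> \<le> \<bar>t - t'\<bar> + \<bar>t - t'\<bar> * (kernel_bound - 1)"
    using mult_left_mono[OF abs_tilt_le[OF assms], of "\<bar>t - t'\<bar>"]
    by (intro order_trans[OF abs_triangle_ineq] add_mono) (auto simp: abs_mult)
  finally show ?thesis
    by (simp add: algebra_simps)
qed

lemma green_dt_0: "0 \<le> s \<Longrightarrow> green_dt \<eta> \<alpha> 0 s = 0"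
  by (simp add: green_dt_eq)

lemma green_0: "0 \<le> s \<Longrightarrow> green \<eta> \<alpha> 0 s = 0"
  by (simp add: green_eq)

lemma abs_green_dt_le:
  assumes "s \<in> {0..1}" "t \<in> {0..1}"
  shows "\<bar>green_dt \<eta> \<alpha> t s\<bar> \<le> kernel_bound"
proof -
  have "\<bar>green_dt \<eta> \<alpha> t s\<bar> \<le> kernel_bound * \<bar>t\<bar>"
    using green_dt_lipschitz[OF assms(1), of t 0] assms by (simp add: green_dt_0)
  also have "\<dots> \<le> kernel_bound * 1"
    using assms kernel_bound_pos by (intro mult_left_mono) auto
  finally show ?thesis by simp
qed

text \<open>
The constant does not depend on \<open>s\<close>. This allows differentiation under the integral sign for any
integrable density.
\<close>

lemma green_taylor:
  assumes "s \<in> {0..1}"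
  shows "\<bar>green \<eta> \<alpha> t' s - green \<eta> \<alpha> t s - (t' - t) * green_dt \<eta> \<alpha> t s\<bar> \<le> kernel_bound * (t' - t)\<^sup>2"
proof -
  define d where "d = t' - t"
  have t': "t' = t + d" by (simp add: d_def)
  have 1: "\<bar>(t'\<^sup>2 - (max 0 (t' - s))\<^sup>2) / 2 - (t\<^sup>2 - (max 0 (t - s))\<^sup>2) / 2 - d * min s t\<bar> \<le> d\<^sup>2"
  proof -
    \<comment> \<open>Exact if \<open>s\<close> lies below both points; otherwise the error consists of half squares of distances of at most \<open>\<bar>t' - t\<bar>\<close>.\<close>
    consider "s \<le> t" "s \<le> t'" | "t < s" "s \<le> t'" | "s \<le> t" "t' < s" | "t < s" "t' < s"
      by linarith
    then show ?thesis
    proof cases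
      case 1
      then have "(t'\<^sup>2 - (max 0 (t' - s))\<^sup>2) / 2 - (t\<^sup>2 - (max 0 (t - s))\<^sup>2) / 2 - d * min s t = 0"
        by (simp add: d_def power2_eq_square field_simps)
      then show ?thesis by simp
    next
      case 2
      then have "(t'\<^sup>2 - (max 0 (t' - s))\<^sup>2) / 2 - (t\<^sup>2 - (max 0 (t - s))\<^sup>2) / 2 - d * min s t
          = d\<^sup>2 / 2 - (t' - s)\<^sup>2 / 2"
        by (simp add: d_def power2_eq_square field_simps)
      moreover have "(t' - s)\<^sup>2 \<le> d\<^sup>2"
        using 2 by (intro power_mono) (auto simp: d_def)
      ultimately show ?thesis
        using zero_le_power2[of "t' - s"] zero_le_power2[of d] unfolding abs_le_iff by linarith
    next
      case 3
      then have "(t'\<^sup>2 - (max 0 (t' - s))\<^sup>2) / 2 - (t\<^sup>2 - (max 0 (t - s))\<^sup>2) / 2 - d * min s t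
          = (s - t')\<^sup>2 / 2"
        by (simp add: d_def power2_eq_square field_simps)
      moreover have "(s - t')\<^sup>2 \<le> (- d)\<^sup>2"
        using 3 by (intro power_mono) (auto simp: d_def)
      ultimately show ?thesis
        using zero_le_power2[of "s - t'"] unfolding abs_le_iff power2_minus by linarith
    next
      case 4
      then have "(t'\<^sup>2 - (max 0 (t' - s))\<^sup>2) / 2 - (t\<^sup>2 - (max 0 (t - s))\<^sup>2) / 2 - d * min s t = d\<^sup>2 / 2"
        by (simp add: d_def power2_eq_square field_simps)
      then show ?thesis
        using zero_le_power2[of d] unfolding abs_le_iff by linarith
    qed
  qed
  have "green \<eta> \<alpha> t' s - green \<eta> \<alpha> t s - (t' - t) * green_dt \<eta> \<alpha> t s
    = ((t'\<^sup>2 - (max 0 (t' - s))\<^sup>2) / 2 - (t\<^sup>2 - (max 0 (t - s))\<^sup>2) / 2 - d * min s t) + d\<^sup>2 / 2 * tilt \<eta> \<alpha> s"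
    unfolding green_eq green_dt_eq d_def by (simp add: power2_eq_square field_simps)
  also have "\<bar>\<dots>\<bar> \<le> d\<^sup>2 + d\<^sup>2 * (kernel_bound - 1)"
  proof (intro order_trans[OF abs_triangle_ineq] add_mono 1)
    have "\<bar>d\<^sup>2 / 2 * tilt \<eta> \<alpha> s\<bar> = d\<^sup>2 / 2 * \<bar>tilt \<eta> \<alpha> s\<bar>"
      by (simp add: abs_mult)
    also have "\<dots> \<le> d\<^sup>2 * (kernel_bound - 1)"
      using abs_tilt_le[OF assms] by (intro mult_mono) auto
    finally show "\<bar>d\<^sup>2 / 2 * tilt \<eta> \<alpha> s\<bar> \<le> d\<^sup>2 * (kernel_bound - 1)" .
  qed
  finally show ?thesis
    by (simp add: d_def algebra_simps)
qed

lemma abs_green_le: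
  assumes "s \<in> {0..1}" "t \<in> {0..1}"
  shows "\<bar>green \<eta> \<alpha> t s\<bar> \<le> kernel_bound"
proof -
  have "\<bar>green \<eta> \<alpha> t s\<bar> \<le> kernel_bound * t\<^sup>2"
    using green_taylor[OF assms(1), of t 0] assms by (simp add: green_0 green_dt_0)
  also have "\<dots> \<le> kernel_bound * 1"
    using assms kernel_bound_pos by (intro mult_left_mono) (auto simp: power_le_one)
  finally show ?thesis by simp
qed

text \<open>
As a function of \<open>t\<close>, the kernel is nonnegative and concave with value \<open>0\<close> at \<open>0\<close>. For \<open>s \<le> \<eta>\<close> it is nondecreasing, so its
maximum is the value at \<open>1\<close> and \<open>t\<close> times it is a lower bound by concavity. For \<open>s > \<eta>\<close> the maximum is at most
\<open>(1 - s) / (1 - \<alpha> * \<eta>)\<close>; the kernel equals \<open>t\<close> times this number up to \<open>s\<close> and is above \<open>\<eta>\<close> times it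
afterwards, because \<open>\<alpha> > 1\<close> keeps the value at \<open>1\<close> large enough.
\<close>

lemma green_dt_cone:
  assumes s: "s \<in> {0..1}" and t: "t \<in> {0..1}" and t': "t' \<in> {0..1}"
  shows "min t \<eta> * green_dt \<eta> \<alpha> t' s \<le> green_dt \<eta> \<alpha> t s"
proof -
  define e where "e = 1 - \<alpha> * \<eta>"
  have e: "e > 0" "\<alpha> * \<eta> = 1 - e"
    using alpha_eta_less_1 by (auto simp: e_def)
  have ae: "0 < \<alpha> * \<eta>" "\<eta> \<le> \<alpha> * \<eta>"
    using alpha_gt_1 eta_pos by auto
  show ?thesis
  proof (cases "s \<le> \<eta>")
    case True
    define k where "k = (\<alpha> - 1) * s / (1 - \<alpha> * \<eta>)"
    have k0: "k \<ge> 0"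
      using s alpha_gt_1 alpha_eta_less_1 by (simp add: k_def)
    have gd: "green_dt \<eta> \<alpha> t s = min s t + t * k" for t
      using True by (simp add: green_dt_eq tilt_def k_def algebra_simps)
    have "t' * k \<le> 1 * k"
      using t' k0 by (intro mult_right_mono) auto
    then have "min t \<eta> * green_dt \<eta> \<alpha> t' s \<le> t * (s + k)"
      unfolding gd using s t t' k0 eta_pos by (intro mult_mono) auto
    also have "\<dots> \<le> min s t + t * k"
      using s t mult_left_mono[of s 1 t] mult_right_mono[of t 1 s] by (simp add: algebra_simps)
    finally show ?thesis by (simp add: gd)
  next
    case False
    define N where "N t = (if s \<le> t then s * (1 - t) + \<alpha> * \<eta> * (t - s) else t * (1 - s))" for t
    have gd: "green_dt \<eta> \<alpha> t s = N t / e" for t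
      using False alpha_eta_less_1 by (simp add: green_dt_eq tilt_def N_def e_def field_simps min_def)
    have up: "N t' \<le> 1 - s"
    proof (cases "s \<le> t'")
      case True
      have "s * (1 - t') + \<alpha> * \<eta> * (t' - s) \<le> 1 * (1 - t') + 1 * (t' - s)"
        using s t' True alpha_eta_less_1 by (intro add_mono mult_right_mono) auto
      then show ?thesis using True by (simp add: N_def)
    next
      case False
      then show ?thesis using s t' mult_right_mono[of t' 1 "1 - s"] by (simp add: N_def)
    qed
    have low: "min t \<eta> * (1 - s) \<le> N t"
    proof (cases "s \<le> t")
      case True
      have "min t \<eta> * (1 - s) \<le> \<eta> * (1 - s)"
        using s by (intro mult_right_mono) auto
      also have "\<dots> = \<eta> * (1 - t) + \<eta> * (t - s)"
        by (simp add: algebra_simps)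
      also have "\<dots> \<le> s * (1 - t) + \<alpha> * \<eta> * (t - s)"
        using False True t ae by (intro add_mono mult_right_mono) auto
      finally show ?thesis using True by (simp add: N_def)
    next
      case False
      then show ?thesis using s by (simp add: N_def mult_right_mono)
    qed
    have "min t \<eta> * N t' \<le> min t \<eta> * (1 - s)"
      using up t eta_pos by (intro mult_left_mono) auto
    with low have "min t \<eta> * N t' / e \<le> N t / e"
      using e by (intro divide_right_mono) auto
    then show ?thesis
      by (simp add: gd)
  qed
qed

lemma green_dt_nonneg:
  assumes "s \<in> {0..1}" "t \<in> {0..1}"
  shows "0 \<le> green_dt \<eta> \<alpha> t s"
  using green_dt_cone[OF assms, of 0] assms by (simp add: green_dt_0)

lemma green_nonneg:
  assumes "s \<in> {0..1}" "t \<in> {0..1}"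
  shows "0 \<le> green \<eta> \<alpha> t s"
proof (cases "s \<le> \<eta>")
  case True
  have "(max 0 (t - s))\<^sup>2 \<le> t\<^sup>2"
    using assms by (intro power_mono) auto
  moreover have "0 \<le> t\<^sup>2 * tilt \<eta> \<alpha> s"
    using True assms alpha_gt_1 alpha_eta_less_1 by (simp add: tilt_def)
  ultimately show ?thesis by (simp add: green_eq)
next
  case False
  have ae: "0 < \<alpha> * \<eta>"
    using alpha_gt_1 eta_pos by simp
  show ?thesis
  proof (cases "s \<le> t")
    case True
    \<comment> \<open>The factor in parentheses is the numerator of \<open>green_dt\<close> in this case; passing from \<open>t * s\<close> to \<open>2 * t * s - s\<^sup>2\<close> uses \<open>s \<le> t\<close>.\<close>
    have "0 \<le> t * (s * (1 - t) + \<alpha> * \<eta> * (t - s))"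
      using assms True ae by simp
    also have "\<dots> = t * s * (1 - \<alpha> * \<eta>) + t\<^sup>2 * (\<alpha> * \<eta> - s)"
      by (simp add: power2_eq_square algebra_simps)
    also have "\<dots> \<le> (2 * t * s - s\<^sup>2) * (1 - \<alpha> * \<eta>) + t\<^sup>2 * (\<alpha> * \<eta> - s)"
      using True assms alpha_eta_less_1
      by (intro add_right_mono mult_right_mono) (auto simp: power2_eq_square mult_left_mono)
    finally show ?thesis
      using False True alpha_eta_less_1 by (simp add: green_def)
  next
    case f: False
    then show ?thesis
      using False assms alpha_eta_less_1 by (simp add: green_def)
  qed
qed

lemma green_lower:
  assumes "s \<in> {\<eta>/\<alpha>..\<eta>}" "t \<in> {\<eta>/\<alpha>..\<eta>}"
  shows "(\<eta>/\<alpha>)\<^sup>2 / 2 \<le> green \<eta> \<alpha> t s"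
proof -
  have a: "0 < \<eta>/\<alpha>"
    using eta_pos alpha_gt_1 by simp
  have "(\<eta>/\<alpha>)\<^sup>2 + (max 0 (t - s))\<^sup>2 \<le> t\<^sup>2"
  proof (cases "s \<le> t")
    case True
    have "(\<eta>/\<alpha>)\<^sup>2 \<le> s\<^sup>2"
      using assms a by (intro power_mono) auto
    also have "s\<^sup>2 + (t - s)\<^sup>2 \<le> t\<^sup>2"
      using True assms a mult_left_mono[of s t s] by (simp add: power2_eq_square algebra_simps)
    ultimately show ?thesis using True by simp
  next
    case False
    then show ?thesis
      using assms a by (simp add: power_mono)
  qed
  moreover have "0 \<le> t\<^sup>2 * tilt \<eta> \<alpha> s"
    using assms a alpha_gt_1 alpha_eta_less_1 by (simp add: tilt_def)
  ultimately show ?thesis by (simp add: green_eq)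
qed

lemma measurable_tilt [measurable]: "tilt \<eta> \<alpha> \<in> borel_measurable borel"
  unfolding tilt_def by measurable

lemma measurable_green [measurable]: "green \<eta> \<alpha> t \<in> borel_measurable borel"
  unfolding green_eq[abs_def] by measurable

lemma measurable_green_dt [measurable]: "green_dt \<eta> \<alpha> t \<in> borel_measurable borel"
  unfolding green_dt_eq[abs_def] by measurable

end

section \<open>Integral operators with the Green's function as kernel\<close>

lemma borel_measurable_unit_leb: "k \<in> borel_measurable borel \<Longrightarrow> k \<in> borel_measurable unit_leb"
  by (intro measurable_restrict_space1 measurable_completion) simp

lemma kernel_integral:
  fixes h k :: "real \<Rightarrow> real"
  assumes h: "integrable unit_leb h" and k: "k \<in> borel_measurable borel"
    and C: "\<And>s. s \<in> {0..1} \<Longrightarrow> \<bar>k s\<bar> \<le> C"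
  shows integrable_kernel_mult: "integrable unit_leb (\<lambda>s. k s * h s)"
    and abs_kernel_integral_le: "\<bar>LINT s|unit_leb. k s * h s\<bar> \<le> C * (LINT s|unit_leb. \<bar>h s\<bar>)"
proof -
  have bd: "\<bar>k s * h s\<bar> \<le> C * \<bar>h s\<bar>" if "s \<in> {0..1}" for s
    using C[OF that] by (simp add: abs_mult mult_right_mono)
  have meas: "(\<lambda>s. k s * h s) \<in> borel_measurable unit_leb"
    using h borel_measurable_unit_leb[OF k] by (intro borel_measurable_times) auto
  have int: "integrable unit_leb (\<lambda>s. C * \<bar>h s\<bar>)"
    using h by (intro integrable_mult_right integrable_abs)
  show 1: "integrable unit_leb (\<lambda>s. k s * h s)"
    by (rule Bochner_Integration.integrable_bound[OF int meas])
       (use bd in \<open>auto intro!: AE_I2 order_trans[OF bd abs_ge_self]\<close>)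
  have "\<bar>LINT s|unit_leb. k s * h s\<bar> \<le> (LINT s|unit_leb. \<bar>k s * h s\<bar>)"
    by (rule integral_abs_bound)
  also have "\<dots> \<le> (LINT s|unit_leb. C * \<bar>h s\<bar>)"
    using 1 int bd by (intro integral_mono integrable_abs) auto
  finally show "\<bar>LINT s|unit_leb. k s * h s\<bar> \<le> C * (LINT s|unit_leb. \<bar>h s\<bar>)"
    by simp
qed

context three_point
begin

definition green_int :: "(real \<Rightarrow> real) \<Rightarrow> real \<Rightarrow> real" where
  "green_int h t = (LINT s|unit_leb. green \<eta> \<alpha> t s * h s)"

definition green_dt_int :: "(real \<Rightarrow> real) \<Rightarrow> real \<Rightarrow> real" where
  "green_dt_int h t = (LINT s|unit_leb. green_dt \<eta> \<alpha> t s * h s)"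

lemma integrable_green:
  assumes "integrable unit_leb h" "t \<in> {0..1}"
  shows "integrable unit_leb (\<lambda>s. green \<eta> \<alpha> t s * h s)"
  using assms abs_green_le by (intro integrable_kernel_mult) auto

lemma integrable_green_dt:
  assumes "integrable unit_leb h" "t \<in> {0..1}"
  shows "integrable unit_leb (\<lambda>s. green_dt \<eta> \<alpha> t s * h s)"
  using assms abs_green_dt_le by (intro integrable_kernel_mult) auto

lemma green_int_0: "green_int h 0 = 0"
proof -
  have "green_int h 0 = (LINT s|unit_leb. 0)"
    unfolding green_int_def by (intro Bochner_Integration.integral_cong) (auto simp: green_0)
  then show ?thesis by simp
qed

lemma green_dt_int_cone:
  assumes h: "integrable unit_leb h" "AE s in unit_leb. 0 \<le> h s" and t: "t \<in> {0..1}" "t' \<in> {0..1}"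
  shows "min t \<eta> * green_dt_int h t' \<le> green_dt_int h t"
proof -
  have "min t \<eta> * green_dt_int h t' = (LINT s|unit_leb. min t \<eta> * (green_dt \<eta> \<alpha> t' s * h s))"
    unfolding green_dt_int_def by simp
  also have "\<dots> \<le> green_dt_int h t"
    unfolding green_dt_int_def
  proof (rule integral_mono_AE)
    show "AE s in unit_leb. min t \<eta> * (green_dt \<eta> \<alpha> t' s * h s) \<le> green_dt \<eta> \<alpha> t s * h s"
      using h(2) AE_space
      by eventually_elim (use green_dt_cone t in \<open>auto simp: mult.assoc[symmetric] intro!: mult_right_mono\<close>)
  qed (use h t in \<open>auto intro!: integrable_mult_right integrable_green_dt\<close>)
  finally show ?thesis .
qed

lemma green_dt_int_nonneg:
  assumes "AE s in unit_leb. 0 \<le> h s" and t: "t \<in> {0..1}"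
  shows "0 \<le> green_dt_int h t"
  unfolding green_dt_int_def
proof (rule integral_nonneg_AE)
  show "AE s in unit_leb. 0 \<le> green_dt \<eta> \<alpha> t s * h s"
    using assms(1) AE_space by eventually_elim (use green_dt_nonneg t in auto)
qed

lemma green_dt_int_lipschitz:
  assumes h: "integrable unit_leb h" and t: "t \<in> {0..1}" "t' \<in> {0..1}"
  shows "\<bar>green_dt_int h t - green_dt_int h t'\<bar> \<le> kernel_bound * (LINT s|unit_leb. \<bar>h s\<bar>) * \<bar>t - t'\<bar>"
proof -
  have "green_dt_int h t - green_dt_int h t'
      = (LINT s|unit_leb. (green_dt \<eta> \<alpha> t s - green_dt \<eta> \<alpha> t' s) * h s)"
    unfolding green_dt_int_def left_diff_distrib
    using h t by (intro Bochner_Integration.integral_diff[symmetric] integrable_green_dt)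
  also have "\<bar>\<dots>\<bar> \<le> (kernel_bound * \<bar>t - t'\<bar>) * (LINT s|unit_leb. \<bar>h s\<bar>)"
    using h green_dt_lipschitz by (intro abs_kernel_integral_le) auto
  finally show ?thesis by (simp add: mult_ac)
qed

lemma green_dt_int_diff:
  assumes h: "integrable unit_leb h" "integrable unit_leb h'" and t: "t \<in> {0..1}"
  shows "\<bar>green_dt_int h t - green_dt_int h' t\<bar> \<le> kernel_bound * (LINT s|unit_leb. \<bar>h s - h' s\<bar>)"
proof -
  have "green_dt_int h t - green_dt_int h' t = (LINT s|unit_leb. green_dt \<eta> \<alpha> t s * (h s - h' s))"
    unfolding green_dt_int_def right_diff_distrib
    using h t by (intro Bochner_Integration.integral_diff[symmetric] integrable_green_dt)
  also have "\<bar>\<dots>\<bar> \<le> kernel_bound * (LINT s|unit_leb. \<bar>h s - h' s\<bar>)"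
    using h t abs_green_dt_le by (intro abs_kernel_integral_le) auto
  finally show ?thesis .
qed

text \<open>
By \<open>green_taylor\<close> the difference quotient differs from the integral of \<open>green_dt\<close> by at most a multiple of the
increment.
\<close>

lemma green_int_has_derivative:
  assumes h: "integrable unit_leb h" and t: "t \<in> {0..1}"
  shows "(green_int h has_real_derivative green_dt_int h t) (at t within {0..1})"
  unfolding has_field_derivative_iff
proof (rule LIM_zero_cancel, rule Lim_null_comparison)
  define H where "H = (LINT s|unit_leb. \<bar>h s\<bar>)"
  have *: "\<bar>green_int h t' - green_int h t - (t' - t) * green_dt_int h t\<bar> \<le> kernel_bound * (t' - t)\<^sup>2 * H"
    if t': "t' \<in> {0..1}" for t'
  proof -
    have "green_int h t' - green_int h t - (t' - t) * green_dt_int h t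
        = (LINT s|unit_leb. green \<eta> \<alpha> t' s * h s - green \<eta> \<alpha> t s * h s - (t' - t) * (green_dt \<eta> \<alpha> t s * h s))"
      unfolding green_int_def green_dt_int_def
      using h t t' by (simp add: integrable_green integrable_green_dt)
    also have "\<dots> = (LINT s|unit_leb. (green \<eta> \<alpha> t' s - green \<eta> \<alpha> t s - (t' - t) * green_dt \<eta> \<alpha> t s) * h s)"
      by (simp add: algebra_simps)
    also have "\<bar>\<dots>\<bar> \<le> (kernel_bound * (t' - t)\<^sup>2) * H"
      unfolding H_def using h green_taylor by (intro abs_kernel_integral_le) auto
    finally show ?thesis .
  qed
  show "\<forall>\<^sub>F t' in at t within {0..1}.
      norm ((green_int h t' - green_int h t) / (t' - t) - green_dt_int h t) \<le> kernel_bound * \<bar>t' - t\<bar> * H"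
    unfolding eventually_at_filter
  proof (intro always_eventually allI impI)
    fix t' assume t': "t' \<noteq> t" "t' \<in> {0..1}"
    have "norm ((green_int h t' - green_int h t) / (t' - t) - green_dt_int h t)
        = \<bar>green_int h t' - green_int h t - (t' - t) * green_dt_int h t\<bar> / \<bar>t' - t\<bar>"
      using t' by (simp add: abs_divide[symmetric] diff_divide_distrib)
    also have "\<dots> \<le> kernel_bound * (t' - t)\<^sup>2 * H / \<bar>t' - t\<bar>"
      using *[OF t'(2)] by (intro divide_right_mono) auto
    also have "\<dots> = kernel_bound * \<bar>t' - t\<bar> * H"
      using t' by (simp add: power2_eq_square abs_if field_simps)
    finally show "norm ((green_int h t' - green_int h t) / (t' - t) - green_dt_int h t) \<le> kernel_bound * \<bar>t' - t\<bar> * H" .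
  qed
  show "((\<lambda>t'. kernel_bound * \<bar>t' - t\<bar> * H) \<longlongrightarrow> 0) (at t within {0..1})"
    by (auto intro!: tendsto_eq_intros)
qed

lemma continuous_green_dt_int:
  assumes h: "integrable unit_leb h"
  shows "continuous_on {0..1} (green_dt_int h)"
proof (rule lipschitz_on_continuous_on)
  show "(kernel_bound * (LINT s|unit_leb. \<bar>h s\<bar>))-lipschitz_on {0..1} (green_dt_int h)"
    using green_dt_int_lipschitz[OF h] kernel_bound_pos
    by (intro lipschitz_onI) (auto simp: dist_real_def)
qed

lemma green_int_eq_integral:
  assumes h: "integrable unit_leb h" and t: "t \<in> {0..1}"
  shows "green_int h t = integral {0..t} (green_dt_int h)"
proof -
  have "(green_dt_int h has_integral green_int h t - green_int h 0) {0..t}"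
  proof (rule fundamental_theorem_of_calculus)
    fix x assume "x \<in> {0..t}"
    then show "(green_int h has_vector_derivative green_dt_int h x) (at x within {0..t})"
      using green_int_has_derivative[OF h, of x] t
      by (auto simp: has_real_derivative_iff_has_vector_derivative
               intro: has_vector_derivative_within_subset)
  qed (use t in auto)
  then show ?thesis
    by (simp add: green_int_0 integral_unique)
qed

end

section \<open>Superposition with a Caratheodory function\<close>

text \<open>
The nonlinearity is continuous only for almost every \<open>t\<close>, so its superposition with a function is an almost everywhere
limit of measurable functions. Completeness of the measure makes it measurable itself.
\<close>

lemma (in complete_measure) measurable_AE_eq:
  assumes f: "f \<in> measurable M N" and eq: "AE x in M. f x = f' x"
    and f': "\<And>x. x \<in> space M \<Longrightarrow> f' x \<in> space N"
  shows "f' \<in> measurable M N"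
proof (rule measurableI)
  fix A assume A: "A \<in> sets N"
  show "f' -` A \<inter> space M \<in> sets M"
  proof (rule in_sets_AE)
    show "AE x in M. x \<in> f -` A \<inter> space M \<longleftrightarrow> x \<in> f' -` A \<inter> space M"
      using eq by eventually_elim auto
    show "f -` A \<inter> space M \<in> sets M"
      using f A by (rule measurable_sets)
  qed auto
qed (use f' in auto)

text \<open>
For a simple function \<open>h\<close> only finitely many sections \<open>\<lambda>x. f x y\<close> are involved. The general case follows by
continuity in the second argument along simple functions that converge to \<open>h\<close>.
\<close>

lemma (in complete_measure) caratheodory_composition:
  fixes f :: "'a \<Rightarrow> 'b::{metric_space, second_countable_topology} \<Rightarrow> real"
  assumes meas: "\<And>y. (\<lambda>x. f x y) \<in> borel_measurable M"
    and cont: "AE x in M. continuous_on UNIV (f x)" and h: "h \<in> borel_measurable M"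
  shows "(\<lambda>x. f x (h x)) \<in> borel_measurable M"
proof -
  obtain F where F: "\<And>i. simple_function M (F i)" "\<And>x. x \<in> space M \<Longrightarrow> (\<lambda>i. F i x) \<longlonglongrightarrow> h x"
    using borel_measurable_implies_sequence_metric[OF h] by blast
  have Fm: "(\<lambda>x. f x (F i x)) \<in> borel_measurable M" for i
  proof (rule measurable_compose_countable'[where f = "\<lambda>y x. f x y" and I = "F i ` space M"])
    show "F i \<in> measurable M (count_space (F i ` space M))"
      using F(1)[of i] by (auto simp: simple_function_def intro!: measurable_count_space_eq2[THEN iffD2])
    show "countable (F i ` space M)"
      using F(1)[of i] by (auto simp: simple_function_def intro: countable_finite)
  qed (rule meas)
  have "(\<lambda>x. lim (\<lambda>i. f x (F i x))) \<in> borel_measurable M"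
    using Fm by (rule borel_measurable_lim_metric)
  then show ?thesis
  proof (rule measurable_AE_eq)
    show "AE x in M. lim (\<lambda>i. f x (F i x)) = f x (h x)"
      using cont AE_space
    proof eventually_elim
      case (elim x)
      have "(\<lambda>i. f x (F i x)) \<longlonglongrightarrow> f x (h x)"
        by (rule continuous_on_tendsto_compose[OF elim(1) F(2)[OF elim(2)]]) auto
      then show ?case by (rule limI)
    qed
  qed auto
qed

lemma complete_measure_unit_leb: "complete_measure unit_leb"
proof
  fix A B :: "real set" assume "B \<subseteq> A" "A \<in> null_sets unit_leb"
  then have "B \<subseteq> {0..1}" "B \<in> null_sets lebesgue"
    by (auto simp: null_sets_restrict_space intro: completion.complete2)
  then show "B \<in> sets unit_leb"
    by (auto simp: sets_restrict_space null_sets_def intro!: image_eqI[of _ _ B])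
qed

text \<open>
The nonlinearity along the functions with slopes \<open>x\<close>, \<open>y\<close> and value \<open>0\<close> at \<open>0\<close>.
\<close>

definition nemytskii ::
  "(real \<Rightarrow> real \<Rightarrow> real \<Rightarrow> real \<Rightarrow> real \<Rightarrow> real) \<Rightarrow> (real \<Rightarrow> real) \<Rightarrow> (real \<Rightarrow> real) \<Rightarrow> real \<Rightarrow> real" where
  "nemytskii f x y s = f s (integral {0..s} x) (x s) (integral {0..s} y) (y s)"

definition admissible :: "real \<Rightarrow> (real \<Rightarrow> real) \<Rightarrow> bool" where
  "admissible R x \<longleftrightarrow> continuous_on {0..1} x \<and> (\<forall>s\<in>{0..1}. 0 \<le> x s \<and> x s \<le> R)"

lemma admissible_mono: "admissible R x \<Longrightarrow> R \<le> R' \<Longrightarrow> admissible R' x"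
  by (force simp: admissible_def)

lemma admissible_integral:
  assumes "admissible R x" "s \<in> {0..1}"
  shows "0 \<le> integral {0..s} x" "integral {0..s} x \<le> R * s" "integral {0..s} x \<le> R"
    "x integrable_on {0..s}"
proof -
  have c: "continuous_on {0..s} x"
    using assms by (auto simp: admissible_def intro: continuous_on_subset)
  then show int: "x integrable_on {0..s}"
    by (rule integrable_continuous_interval)
  have R: "0 \<le> R"
    using assms by (force simp: admissible_def)
  show "0 \<le> integral {0..s} x"
    using assms by (intro integral_nonneg int) (auto simp: admissible_def)
  have "integral {0..s} x \<le> integral {0..s} (\<lambda>_. R)"
    using assms by (intro integral_le int) (auto simp: admissible_def)
  also have "\<dots> = R * s"
    using assms by simp
  finally show 1: "integral {0..s} x \<le> R * s" .
  also have "\<dots> \<le> R"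
    using assms R mult_left_mono[of s 1 R] by simp
  finally show "integral {0..s} x \<le> R" .
qed

lemma admissible_continuous_integral:
  assumes "admissible R x"
  shows "continuous_on {0..1} (\<lambda>s. integral {0..s} x)"
  using assms by (intro indefinite_integral_continuous_1 integrable_continuous_interval) (auto simp: admissible_def)

lemma continuous_on_imp_measurable_unit_leb:
  fixes h :: "real \<Rightarrow> 'a::topological_space"
  shows "continuous_on {0..1} h \<Longrightarrow> h \<in> borel_measurable unit_leb"
  by (rule continuous_imp_measurable_on_sets_lebesgue) auto

text \<open>
The simple functions that approximate the arguments may be negative somewhere, while continuity is known only for nonnegative
arguments. Composition with \<open>max 0\<close> extends the nonlinearity continuously to all arguments.
\<close>

lemma nemytskii_measurable:
  assumes f: "Linfty_Caratheodory f" and x: "admissible R x" and y: "admissible R y"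
  shows "nemytskii f x y \<in> borel_measurable unit_leb"
proof -
  interpret complete_measure unit_leb
    by (rule complete_measure_unit_leb)
  define f' where "f' t = (\<lambda>(u1, u2, v1, v2). f t (max 0 u1) (max 0 u2) (max 0 v1) (max 0 v2))" for t
  define h where "h s = (integral {0..s} x, x s, integral {0..s} y, y s)" for s
  have "(\<lambda>s. f' s (h s)) \<in> borel_measurable unit_leb"
  proof (rule caratheodory_composition[of f' h])
    show "(\<lambda>s. f' s q) \<in> borel_measurable unit_leb" for q
      using f by (cases q) (auto simp: f'_def Linfty_Caratheodory_def)
    have "AE t in unit_leb. continuous_on ({0..} \<times> {0..} \<times> {0..} \<times> {0..})
                          (\<lambda>(u1, u2, v1, v2). f t u1 u2 v1 v2)"
      using f by (auto simp: Linfty_Caratheodory_def)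
    then show "AE t in unit_leb. continuous_on UNIV (f' t)"
    proof eventually_elim
      case (elim t)
      have "continuous_on UNIV ((\<lambda>(u1, u2, v1, v2). f t u1 u2 v1 v2) \<circ>
          (\<lambda>q::real \<times> real \<times> real \<times> real. (max 0 (fst q), max 0 (fst (snd q)), max 0 (fst (snd (snd q))), max 0 (snd (snd (snd q))))))"
        by (intro continuous_on_compose continuous_intros continuous_on_subset[OF elim]) auto
      then show ?case
        by (simp add: f'_def o_def case_prod_beta)
    qed
    have "continuous_on {0..1} h"
      unfolding h_def using x y
      by (intro continuous_on_Pair admissible_continuous_integral) (auto simp: admissible_def)
    then show "h \<in> borel_measurable unit_leb"
      by (rule continuous_on_imp_measurable_unit_leb)
  qed
  moreover have "f' s (h s) = nemytskii f x y s" if "s \<in> space unit_leb" for s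
    using that x y admissible_integral(1)[OF x, of s] admissible_integral(1)[OF y, of s]
    by (simp add: f'_def h_def nemytskii_def admissible_def max_def)
  ultimately show ?thesis
    using measurable_cong[of unit_leb "\<lambda>s. f' s (h s)" "nemytskii f x y"] by blast
qed

text \<open>
One null set serves all admissible slopes, because the bound in the Caratheodory condition is uniform in the arguments.
\<close>

lemma nemytskii_bounded:
  assumes f: "Linfty_Caratheodory f" and "R > 0"
    and nonneg: "\<And>t u1 u2 v1 v2. \<lbrakk>t \<in> {0..1}; u1 \<ge> 0; u2 \<ge> 0; v1 \<ge> 0; v2 \<ge> 0\<rbrakk> \<Longrightarrow> f t u1 u2 v1 v2 \<ge> 0"
  obtains C where "C \<ge> 0" "AE s in unit_leb. \<forall>x y. admissible R x \<longrightarrow> admissible R y \<longrightarrow> \<bar>nemytskii f x y s\<bar> \<le> C"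
proof -
  obtain \<phi> B where "AE t in unit_leb. \<bar>\<phi> t\<bar> \<le> B"
      "AE t in unit_leb. \<forall>u1\<in>{0..R}. \<forall>u2\<in>{0..R}. \<forall>v1\<in>{0..R}. \<forall>v2\<in>{0..R}. f t u1 u2 v1 v2 \<le> \<phi> t"
    using f \<open>R > 0\<close> unfolding Linfty_Caratheodory_def Linfty_def by meson
  then have "AE s in unit_leb. \<forall>x y. admissible R x \<longrightarrow> admissible R y \<longrightarrow> \<bar>nemytskii f x y s\<bar> \<le> max 0 B"
    using AE_space
  proof eventually_elim
    case (elim s)
    show ?case
    proof (intro allI impI)
      fix x y assume x: "admissible R x" and y: "admissible R y"
      have s: "s \<in> {0..1}"
        using elim(3) by simp
      have *: "integral {0..s} x \<in> {0..R}" "integral {0..s} y \<in> {0..R}" "x s \<in> {0..R}" "y s \<in> {0..R}"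
        using admissible_integral[OF x s] admissible_integral[OF y s] x y s by (auto simp: admissible_def)
      then have "nemytskii f x y s \<le> \<phi> s"
        using elim(2) by (simp add: nemytskii_def)
      moreover have "0 \<le> nemytskii f x y s"
        using * s by (simp add: nemytskii_def nonneg)
      ultimately show "\<bar>nemytskii f x y s\<bar> \<le> max 0 B"
        using elim(1) by simp
    qed
  qed
  then show thesis
    by (rule that[rotated]) simp
qed

lemma nemytskii_tendsto:
  assumes f: "Linfty_Caratheodory f"
    and xn: "\<And>n. admissible R (xn n)" and x: "admissible R x"
    and yn: "\<And>n. admissible R (yn n)" and y: "admissible R y"
    and limx: "uniform_limit {0..1} xn x sequentially" and limy: "uniform_limit {0..1} yn y sequentially"
  shows "AE s in unit_leb. (\<lambda>n. nemytskii f (xn n) (yn n) s) \<longlonglongrightarrow> nemytskii f x y s"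
proof -
  have int_lim: "(\<lambda>n. integral {0..s} (zn n)) \<longlonglongrightarrow> integral {0..s} z"
    if zn: "\<And>n. admissible R (zn n)" and lim: "uniform_limit {0..1} zn z sequentially" and s: "s \<in> {0..1}" for zn z s
  proof -
    have sub: "{0..s} \<subseteq> {0..1}"
      using s by auto
    have "\<And>n. continuous_on {0..s} (zn n)"
      using zn by (intro continuous_on_subset[OF _ sub]) (simp add: admissible_def)
    then obtain I J where "\<And>n. (zn n has_integral I n) {0..s}" "(z has_integral J) {0..s}" "I \<longlonglongrightarrow> J"
      using uniform_limit_integral[OF uniform_limit_on_subset[OF lim sub] _ sequentially_bot] by blast
    moreover from this have "I = (\<lambda>n. integral {0..s} (zn n))"
      by (intro ext) (metis integral_unique)
    ultimately show ?thesis
      by (simp add: integral_unique)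
  qed
  have "AE t in unit_leb. continuous_on ({0..} \<times> {0..} \<times> {0..} \<times> {0..})
                          (\<lambda>(u1, u2, v1, v2). f t u1 u2 v1 v2)"
    using f by (auto simp: Linfty_Caratheodory_def)
  then show ?thesis
    using AE_space
  proof eventually_elim
    case (elim s)
    then have s: "s \<in> {0..1}" by simp
    have dom: "(integral {0..s} x, x s, integral {0..s} y, y s) \<in> {0..} \<times> {0..} \<times> {0..} \<times> {0..}"
      if "admissible R x" "admissible R y" for x y
      using that admissible_integral(1)[OF that(1) s] admissible_integral(1)[OF that(2) s] s
      by (simp add: admissible_def)
    have "(\<lambda>n. (integral {0..s} (xn n), xn n s, integral {0..s} (yn n), yn n s))
        \<longlonglongrightarrow> (integral {0..s} x, x s, integral {0..s} y, y s)"
      by (intro tendsto_Pair int_lim xn yn limx limy s tendsto_uniform_limitI[OF limx s] tendsto_uniform_limitI[OF limy s])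
    from continuous_on_tendsto_compose[OF elim(1) this dom[OF x y]]
    show ?case
      using dom[OF xn yn] by (simp add: nemytskii_def)
  qed
qed

section \<open>The operator acting on slopes\<close>

lemma lebesgue_on_subinterval:
  assumes "0 \<le> a" "b \<le> (1::real)"
  shows "lebesgue_on {a..b} = restrict_space unit_leb {a..b}"
  using assms by (simp add: restrict_restrict_space inf.absorb2)

lemma integrable_subinterval:
  fixes h :: "real \<Rightarrow> real"
  assumes "0 \<le> a" "b \<le> 1" "integrable unit_leb h"
  shows "integrable (lebesgue_on {a..b}) h"
proof -
  have S: "{a..b} \<in> sets unit_leb"
    using assms by (subst sets_restrict_space_iff) auto
  have "integrable unit_leb (\<lambda>x. indicator {a..b} x *\<^sub>R h x)"
    using S assms(3) by (rule integrable_mult_indicator)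
  with S show ?thesis
    unfolding lebesgue_on_subinterval[OF assms(1,2)]
    by (subst integrable_restrict_space) (auto intro: sets.Int[OF S sets.top, simplified])
qed

lemma integral_subinterval:
  fixes h :: "real \<Rightarrow> real"
  assumes "0 \<le> a" "b \<le> 1"
  shows "(LINT s|lebesgue_on {a..b}. h s) = (LINT s|unit_leb. indicator {a..b} s * h s)"
proof -
  have S: "{a..b} \<in> sets unit_leb"
    using assms by (subst sets_restrict_space_iff) auto
  then show ?thesis
    unfolding lebesgue_on_subinterval[OF assms] by (subst integral_restrict_space) (auto intro: sets.Int[OF S sets.top, simplified])
qed

lemma AE_subinterval:
  assumes "0 \<le> a" "b \<le> (1::real)" "AE s in unit_leb. P s"
  shows "AE s in lebesgue_on {a..b}. P s"
proof -
  have S: "{a..b} \<in> sets unit_leb"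
    using assms by (subst sets_restrict_space_iff) auto
  then show ?thesis
    unfolding lebesgue_on_subinterval[OF assms(1,2)]
    by (subst AE_restrict_space_iff) (use assms(3) in \<open>auto intro: sets.Int[OF S sets.top, simplified]\<close>)
qed

text \<open>
One equation of the system. The first two arguments of \<open>f\<close> after \<open>t\<close> belong to the component that the equation determines; for the second
equation the arguments are exchanged.
\<close>

locale hammerstein = three_point +
  fixes g :: "real \<Rightarrow> real" and f :: "real \<Rightarrow> real \<Rightarrow> real \<Rightarrow> real \<Rightarrow> real \<Rightarrow> real"
  assumes f_nonneg: "\<And>t u1 u2 v1 v2. \<lbrakk>t \<in> {0..1}; u1 \<ge> 0; u2 \<ge> 0; v1 \<ge> 0; v2 \<ge> 0\<rbrakk> \<Longrightarrow> f t u1 u2 v1 v2 \<ge> 0"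
    and f_caratheodory: "Linfty_Caratheodory f"
    and g_integrable: "integrable unit_leb g" and g_nonneg: "AE t in unit_leb. g t \<ge> 0"
begin

definition source :: "(real \<Rightarrow> real) \<Rightarrow> (real \<Rightarrow> real) \<Rightarrow> real \<Rightarrow> real" where
  "source x y s = g s * nemytskii f x y s"

definition slope_op :: "(real \<Rightarrow> real) \<Rightarrow> (real \<Rightarrow> real) \<Rightarrow> real \<Rightarrow> real" where
  "slope_op x y = green_dt_int (source x y)"

lemma nemytskii_nonneg:
  assumes "admissible R x" "admissible R' y" "s \<in> {0..1}"
  shows "0 \<le> nemytskii f x y s"
  unfolding nemytskii_def using assms admissible_integral(1)[OF assms(1,3)] admissible_integral(1)[OF assms(2,3)]
  by (intro f_nonneg) (auto simp: admissible_def)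

lemma source_AE_nonneg:
  assumes "admissible R x" "admissible R' y"
  shows "AE s in unit_leb. 0 \<le> source x y s"
  using g_nonneg AE_space
  by eventually_elim (use nemytskii_nonneg[OF assms] in \<open>auto simp: source_def\<close>)

lemma source_bounded:
  assumes "R > 0"
  obtains C where "C \<ge> 0" "\<And>x y. admissible R x \<Longrightarrow> admissible R y \<Longrightarrow> AE s in unit_leb. \<bar>source x y s\<bar> \<le> C * \<bar>g s\<bar>"
proof -
  obtain C where C: "C \<ge> 0"
    "AE s in unit_leb. \<forall>x y. admissible R x \<longrightarrow> admissible R y \<longrightarrow> \<bar>nemytskii f x y s\<bar> \<le> C"
    using nemytskii_bounded[OF f_caratheodory assms f_nonneg] by blast
  show thesis
  proof (rule that[OF C(1)])
    fix x y assume xy: "admissible R x" "admissible R y"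
    show "AE s in unit_leb. \<bar>source x y s\<bar> \<le> C * \<bar>g s\<bar>"
      using C(2)
    proof eventually_elim
      case (elim s)
      then have "\<bar>g s\<bar> * \<bar>nemytskii f x y s\<bar> \<le> \<bar>g s\<bar> * C"
        using xy by (intro mult_left_mono) auto
      then show ?case
        by (simp add: source_def abs_mult mult.commute)
    qed
  qed
qed

lemma source_measurable:
  assumes "admissible R x" "admissible R y"
  shows "source x y \<in> borel_measurable unit_leb"
  unfolding source_def[abs_def]
  using g_integrable nemytskii_measurable[OF f_caratheodory assms] by (intro borel_measurable_times) auto

lemma source_integrable:
  assumes "R > 0" "admissible R x" "admissible R y"
  shows "integrable unit_leb (source x y)"
proof -
  obtain C where C: "C \<ge> 0" "\<And>x y. admissible R x \<Longrightarrow> admissible R y \<Longrightarrow> AE s in unit_leb. \<bar>source x y s\<bar> \<le> C * \<bar>g s\<bar>"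
    using source_bounded[OF assms(1)] by blast
  show ?thesis
  proof (rule Bochner_Integration.integrable_bound)
    show "integrable unit_leb (\<lambda>s. C * \<bar>g s\<bar>)"
      using g_integrable by (intro integrable_mult_right integrable_abs)
    show "AE s in unit_leb. norm (source x y s) \<le> norm (C * \<bar>g s\<bar>)"
      using C(2)[OF assms(2,3)] by eventually_elim (use C(1) in auto)
  qed (rule source_measurable[OF assms(2,3)])
qed

lemma source_L1_bounded:
  assumes "R > 0"
  obtains H where "H \<ge> 0" "\<And>x y. admissible R x \<Longrightarrow> admissible R y \<Longrightarrow> (LINT s|unit_leb. \<bar>source x y s\<bar>) \<le> H"
proof -
  obtain C where C: "C \<ge> 0" "\<And>x y. admissible R x \<Longrightarrow> admissible R y \<Longrightarrow> AE s in unit_leb. \<bar>source x y s\<bar> \<le> C * \<bar>g s\<bar>"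
    using source_bounded[OF assms(1)] by blast
  show thesis
  proof (rule that)
    show "0 \<le> C * (LINT s|unit_leb. \<bar>g s\<bar>)"
      using C(1) by simp
    fix x y assume xy: "admissible R x" "admissible R y"
    have "(LINT s|unit_leb. \<bar>source x y s\<bar>) \<le> (LINT s|unit_leb. C * \<bar>g s\<bar>)"
      using C(2)[OF xy] source_integrable[OF assms xy] g_integrable
      by (intro integral_mono_AE integrable_abs integrable_mult_right)
    then show "(LINT s|unit_leb. \<bar>source x y s\<bar>) \<le> C * (LINT s|unit_leb. \<bar>g s\<bar>)"
      by simp
  qed
qed

lemma source_L1_tendsto:
  assumes "R > 0"
    and xn: "\<And>n. admissible R (xn n)" and x: "admissible R x"
    and yn: "\<And>n. admissible R (yn n)" and y: "admissible R y"
    and lim: "uniform_limit {0..1} xn x sequentially" "uniform_limit {0..1} yn y sequentially"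
  shows "(\<lambda>n. LINT s|unit_leb. \<bar>source (xn n) (yn n) s - source x y s\<bar>) \<longlonglongrightarrow> 0"
proof -
  obtain C where C: "C \<ge> 0" "\<And>x y. admissible R x \<Longrightarrow> admissible R y \<Longrightarrow> AE s in unit_leb. \<bar>source x y s\<bar> \<le> C * \<bar>g s\<bar>"
    using source_bounded[OF assms(1)] by blast
  have "(\<lambda>n. LINT s|unit_leb. \<bar>source (xn n) (yn n) s - source x y s\<bar>) \<longlonglongrightarrow> (LINT s|unit_leb. 0)"
  proof (rule integral_dominated_convergence)
    show "integrable unit_leb (\<lambda>s. 2 * (C * \<bar>g s\<bar>))"
      using g_integrable by (intro integrable_mult_right integrable_abs)
    show "(\<lambda>s. \<bar>source (xn n) (yn n) s - source x y s\<bar>) \<in> borel_measurable unit_leb" for n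
      using source_measurable[OF xn yn] source_measurable[OF x y] by measurable
    show "AE s in unit_leb. norm \<bar>source (xn n) (yn n) s - source x y s\<bar> \<le> 2 * (C * \<bar>g s\<bar>)" for n
      using C(2)[OF xn[of n] yn[of n]] C(2)[OF x y] by eventually_elim auto
    show "AE s in unit_leb. (\<lambda>n. \<bar>source (xn n) (yn n) s - source x y s\<bar>) \<longlonglongrightarrow> 0"
      using nemytskii_tendsto[OF f_caratheodory xn x yn y lim]
    proof eventually_elim
      case (elim s)
      then have "(\<lambda>n. source (xn n) (yn n) s - source x y s) \<longlonglongrightarrow> g s * nemytskii f x y s - source x y s"
        unfolding source_def by (intro tendsto_intros)
      then show ?case
        by (simp add: source_def tendsto_rabs_zero)
    qed
  qed auto
  then show ?thesis by simp
qed

lemma slope_op_cone: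
  assumes "R > 0" "admissible R x" "admissible R y" "t \<in> {0..1}" "t' \<in> {0..1}"
  shows "min t \<eta> * slope_op x y t' \<le> slope_op x y t"
  unfolding slope_op_def using assms by (intro green_dt_int_cone source_integrable source_AE_nonneg)

lemma slope_op_nonneg:
  assumes "admissible R x" "admissible R' y" "t \<in> {0..1}"
  shows "0 \<le> slope_op x y t"
  unfolding slope_op_def using assms by (intro green_dt_int_nonneg source_AE_nonneg)

lemma slope_op_lipschitz:
  assumes "R > 0"
  obtains L where "L \<ge> 0" "\<And>x y t t'. admissible R x \<Longrightarrow> admissible R y \<Longrightarrow> t \<in> {0..1} \<Longrightarrow> t' \<in> {0..1}
    \<Longrightarrow> \<bar>slope_op x y t - slope_op x y t'\<bar> \<le> L * \<bar>t - t'\<bar>"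
proof -
  obtain H where H: "H \<ge> 0" "\<And>x y. admissible R x \<Longrightarrow> admissible R y \<Longrightarrow> (LINT s|unit_leb. \<bar>source x y s\<bar>) \<le> H"
    using source_L1_bounded[OF assms] by blast
  show thesis
  proof (rule that)
    show "0 \<le> kernel_bound * H"
      using H(1) kernel_bound_pos by simp
    fix x y and t t' :: real
    assume *: "admissible R x" "admissible R y" "t \<in> {0..1}" "t' \<in> {0..1}"
    have "\<bar>slope_op x y t - slope_op x y t'\<bar> \<le> kernel_bound * (LINT s|unit_leb. \<bar>source x y s\<bar>) * \<bar>t - t'\<bar>"
      unfolding slope_op_def using assms * by (intro green_dt_int_lipschitz source_integrable)
    also have "\<dots> \<le> kernel_bound * H * \<bar>t - t'\<bar>"
      using H(2)[OF *(1,2)] kernel_bound_pos by (intro mult_right_mono mult_left_mono) auto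
    finally show "\<bar>slope_op x y t - slope_op x y t'\<bar> \<le> kernel_bound * H * \<bar>t - t'\<bar>" .
  qed
qed

text \<open>
Dominated convergence gives convergence of the densities in \<open>L\<^sup>1\<close>, and the bounded kernel turns this into
convergence that is uniform in \<open>t\<close>.
\<close>

lemma slope_op_uniform_limit:
  assumes "R > 0"
    and xn: "\<And>n. admissible R (xn n)" and x: "admissible R x"
    and yn: "\<And>n. admissible R (yn n)" and y: "admissible R y"
    and lim: "uniform_limit {0..1} xn x sequentially" "uniform_limit {0..1} yn y sequentially"
  shows "uniform_limit {0..1} (\<lambda>n. slope_op (xn n) (yn n)) (slope_op x y) sequentially"
proof (rule uniform_limitI)
  fix e :: real assume "e > 0"
  have "(\<lambda>n. kernel_bound * (LINT s|unit_leb. \<bar>source (xn n) (yn n) s - source x y s\<bar>)) \<longlonglongrightarrow> kernel_bound * 0"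
    by (intro tendsto_intros source_L1_tendsto[of R] assms)
  then have "\<forall>\<^sub>F n in sequentially. kernel_bound * (LINT s|unit_leb. \<bar>source (xn n) (yn n) s - source x y s\<bar>) < e"
    using \<open>e > 0\<close> by (intro order_tendstoD) auto
  then show "\<forall>\<^sub>F n in sequentially. \<forall>t\<in>{0..1}. dist (slope_op (xn n) (yn n) t) (slope_op x y t) < e"
  proof eventually_elim
    case (elim n)
    show ?case
    proof
      fix t :: real assume "t \<in> {0..1}"
      then have "\<bar>slope_op (xn n) (yn n) t - slope_op x y t\<bar>
          \<le> kernel_bound * (LINT s|unit_leb. \<bar>source (xn n) (yn n) s - source x y s\<bar>)"
        unfolding slope_op_def using assms by (intro green_dt_int_diff source_integrable[of R])
      with elim show "dist (slope_op (xn n) (yn n) t) (slope_op x y t) < e"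
        by (simp add: dist_real_def)
    qed
  qed
qed

text \<open>
The integral of \<open>green_dt t s * g s\<close> is at most \<open>1 / m_star\<close>, so a nonlinearity of at most \<open>q * \<rho>\<close> yields
slopes of at most \<open>(q / m_star) * \<rho>\<close>.
\<close>

lemma slope_op_contracts_box:
  assumes "\<rho> > 0" "\<sigma> > 0" and q: "q < m_star \<eta> \<alpha> g"
    and f_le: "\<And>t u1 u2 v1 v2. \<lbrakk>t \<in> {0..1}; u1 \<in> {0..\<rho>}; u2 \<in> {0..\<rho>}; v1 \<in> {0..\<sigma>}; v2 \<in> {0..\<sigma>}\<rbrakk>
            \<Longrightarrow> f t u1 u2 v1 v2 / \<rho> \<le> q"
  shows "\<exists>\<theta><1. \<forall>x y. \<forall>t\<in>{0..1}. admissible \<rho> x \<longrightarrow> admissible \<sigma> y \<longrightarrow> slope_op x y t \<le> \<theta> * \<rho>"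
proof -
  define S where "S = (SUP t\<in>{0..1}. green_dt_int g t)"
  \<comment> \<open>From \<open>0 \<le> q < m_star\<close> it follows that \<open>m_star > 0\<close>, so that the supremum in \<open>m_star\<close> is positive and the quotient is not a division by zero.\<close>
  have "0 \<le> f 0 0 0 0 0 / \<rho>"
    using f_nonneg[of 0 0 0 0 0] \<open>\<rho> > 0\<close> by simp
  also have "\<dots> \<le> q"
    using assms by (intro f_le) auto
  finally have "q \<ge> 0" .
  moreover have qS: "q < 1 / S"
    using q by (simp add: m_star_def S_def green_dt_int_def)
  ultimately have "S > 0"
    by (smt (verit) divide_nonneg_nonpos)
  have "bdd_above (green_dt_int g ` {0..1})"
  proof (rule bdd_aboveI2)
    fix t :: real assume "t \<in> {0..1}"
    then have "\<bar>green_dt_int g t\<bar> \<le> kernel_bound * (LINT s|unit_leb. \<bar>g s\<bar>)"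
      unfolding green_dt_int_def using g_integrable abs_green_dt_le by (intro abs_kernel_integral_le) auto
    then show "green_dt_int g t \<le> kernel_bound * (LINT s|unit_leb. \<bar>g s\<bar>)"
      by simp
  qed
  then have S: "green_dt_int g t \<le> S" if "t \<in> {0..1}" for t
    unfolding S_def using that by (intro cSUP_upper)
  show ?thesis
  proof (intro exI[of _ "q * S"] conjI allI ballI impI)
    show "q * S < 1"
      using qS \<open>S > 0\<close> by (simp add: field_simps)
    fix x y and t :: real
    assume x: "admissible \<rho> x" and y: "admissible \<sigma> y" and t: "t \<in> {0..1}"
    have adm: "admissible (max \<rho> \<sigma>) x" "admissible (max \<rho> \<sigma>) y" and R: "max \<rho> \<sigma> > 0"
      using x y assms by (auto intro: admissible_mono)
    have "slope_op x y t \<le> (LINT s|unit_leb. q * \<rho> * (green_dt \<eta> \<alpha> t s * g s))"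
      unfolding slope_op_def green_dt_int_def
    proof (rule integral_mono_AE)
      show "integrable unit_leb (\<lambda>s. green_dt \<eta> \<alpha> t s * source x y s)"
        by (intro integrable_green_dt source_integrable[OF R] adm t)
      show "integrable unit_leb (\<lambda>s. q * \<rho> * (green_dt \<eta> \<alpha> t s * g s))"
        by (intro integrable_mult_right integrable_green_dt g_integrable t)
      show "AE s in unit_leb. green_dt \<eta> \<alpha> t s * source x y s \<le> q * \<rho> * (green_dt \<eta> \<alpha> t s * g s)"
        using g_nonneg AE_space
      proof eventually_elim
        case (elim s)
        then have s: "s \<in> {0..1}" by simp
        have "nemytskii f x y s / \<rho> \<le> q"
          unfolding nemytskii_def
          using admissible_integral[OF x s] admissible_integral[OF y s] x y s
          by (intro f_le) (auto simp: admissible_def)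
        then have "nemytskii f x y s \<le> q * \<rho>"
          using \<open>\<rho> > 0\<close> by (simp add: field_simps)
        then have "(green_dt \<eta> \<alpha> t s * g s) * nemytskii f x y s \<le> (green_dt \<eta> \<alpha> t s * g s) * (q * \<rho>)"
          using elim green_dt_nonneg[OF s t] by (intro mult_left_mono) auto
        then show ?case
          by (simp add: source_def mult_ac)
      qed
    qed
    also have "\<dots> = q * \<rho> * green_dt_int g t"
      unfolding green_dt_int_def by simp
    also have "\<dots> \<le> q * \<rho> * S"
      using S[OF t] \<open>q \<ge> 0\<close> \<open>\<rho> > 0\<close> by (intro mult_left_mono) auto
    finally show "slope_op x y t \<le> q * S * \<rho>"
      by (simp add: mult_ac)
  qed
qed

text \<open>
The infimum in \<open>M_const\<close> is positive, because on \<open>[\<eta>/\<alpha>, \<eta>]\<close> the kernel is bounded below by a positive multiple of the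
weight in the hypothesis on \<open>g\<close>. Without this, \<open>M_const\<close> would be the default value of a division by zero.
\<close>

lemma green_integral_lower:
  assumes pos: "(LINT s|lebesgue_on {\<eta>/\<alpha>..\<eta>}. (1 + \<alpha>) / (1 - \<alpha> * \<eta>) * s * (1 - s) * g s) > 0"
  obtains k where "k > 0" "\<And>t. t \<in> {\<eta>/\<alpha>..\<eta>} \<Longrightarrow> k \<le> (LINT s|lebesgue_on {\<eta>/\<alpha>..\<eta>}. green \<eta> \<alpha> t s * g s)"
proof -
  define a where "a = \<eta> / \<alpha>"
  define w where "w s = (1 + \<alpha>) / (1 - \<alpha> * \<eta>) * s * (1 - s)" for s
  \<comment> \<open>The weight is \<open>w\<close>; the choice of \<open>c\<close> makes \<open>c * w s = a\<^sup>2 / 2 * (s * (1 - s))\<close>, which is below the lower bound \<open>a\<^sup>2 / 2\<close> of the kernel.\<close>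
  define c where "c = a\<^sup>2 / 2 * ((1 - \<alpha> * \<eta>) / (1 + \<alpha>))"
  have a: "0 < a" "a \<le> \<eta>" "\<eta> \<le> 1" "0 \<le> a"
    using eta_pos eta_less_1 alpha_gt_1 by (auto simp: a_def divide_le_eq)
  have c: "c > 0"
    using a alpha_gt_1 alpha_eta_less_1 by (simp add: c_def)
  have cw: "c * w s \<le> a\<^sup>2 / 2" if "s \<in> {0..1}" for s
  proof -
    have cancel: "A * (p / r) * (r / p * s * (1 - s)) = A * (s * (1 - s))"
      if "p \<noteq> 0" "r \<noteq> 0" for A p r :: real
      using that by simp
    have "c * w s = a\<^sup>2 / 2 * (s * (1 - s))"
      unfolding c_def w_def using alpha_gt_1 alpha_eta_less_1 by (intro cancel) auto
    also have "\<dots> \<le> a\<^sup>2 / 2 * 1"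
      using that by (intro mult_left_mono mult_le_one) auto
    finally show ?thesis by simp
  qed
  have w_int: "integrable (lebesgue_on {a..\<eta>}) (\<lambda>s. w s * g s)"
  proof (rule integrable_subinterval[OF _ _ integrable_kernel_mult[OF g_integrable]])
    show "w \<in> borel_measurable borel"
      unfolding w_def by measurable
    show "\<bar>w s\<bar> \<le> a\<^sup>2 / 2 / c" if "s \<in> {0..1}" for s
    proof -
      have "0 \<le> w s"
        using that alpha_gt_1 alpha_eta_less_1 by (simp add: w_def)
      then show ?thesis
        using cw[OF that] c by (simp add: pos_le_divide_eq mult_ac)
    qed
  qed (use a in auto)
  show thesis
  proof (rule that)
    show "c * (LINT s|lebesgue_on {a..\<eta>}. w s * g s) > 0"
      using mult_pos_pos[OF c pos] by (simp only: w_def a_def)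
    fix t assume t: "t \<in> {\<eta>/\<alpha>..\<eta>}"
    have "c * (LINT s|lebesgue_on {a..\<eta>}. w s * g s) = (LINT s|lebesgue_on {a..\<eta>}. c * (w s * g s))"
      by simp
    also have "\<dots> \<le> (LINT s|lebesgue_on {a..\<eta>}. green \<eta> \<alpha> t s * g s)"
    proof (rule integral_mono_AE)
      show "integrable (lebesgue_on {a..\<eta>}) (\<lambda>s. c * (w s * g s))"
        using w_int by (rule integrable_mult_right)
      show "integrable (lebesgue_on {a..\<eta>}) (\<lambda>s. green \<eta> \<alpha> t s * g s)"
        using a t by (intro integrable_subinterval[OF _ _ integrable_green] g_integrable) (auto simp: a_def)
      have "AE s in lebesgue_on {a..\<eta>}. g s \<ge> 0"
        using a g_nonneg by (intro AE_subinterval[of a \<eta>])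
      then show "AE s in lebesgue_on {a..\<eta>}. c * (w s * g s) \<le> green \<eta> \<alpha> t s * g s"
        using AE_space
      proof eventually_elim
        case (elim s)
        then have s: "s \<in> {\<eta>/\<alpha>..\<eta>}" "s \<in> {0..1}"
          using a by (auto simp: a_def[symmetric])
        have "c * w s \<le> green \<eta> \<alpha> t s"
          using cw[OF s(2)] green_lower[OF s(1) t] by (simp add: a_def)
        then show ?case
          using elim by (simp add: mult.assoc[symmetric] mult_right_mono)
      qed
    qed
    finally show "c * (LINT s|lebesgue_on {a..\<eta>}. w s * g s) \<le> (LINT s|lebesgue_on {\<eta>/\<alpha>..\<eta>}. green \<eta> \<alpha> t s * g s)"
      by (simp add: a_def)
  qed
qed

text \<open>
If the image stayed at or below \<open>\<rho>\<close>, its primitive at \<open>a = \<eta>/\<alpha>\<close> would be at most \<open>a * \<rho> \<le> \<rho>\<close>. That primitive is an integral of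
\<open>green a s\<close> against the density, and already the part over \<open>[a, \<eta>]\<close> exceeds \<open>\<rho>\<close>: there the primitive of \<open>x\<close>
lies in the range for which \<open>f \<ge> q * \<rho>\<close>.
\<close>

lemma slope_op_leaves_box:
  assumes "\<rho> > 0" "\<sigma> > 0" and q: "M_const \<eta> \<alpha> g < q"
    and f_ge: "\<And>t u1 u2 v1 v2. \<lbrakk>t \<in> {\<eta>/\<alpha>..\<eta>}; u1 \<in> {c_const \<eta> \<alpha> * \<rho>..\<rho>}; u2 \<in> {0..\<rho>}; v1 \<in> {0..\<sigma>}; v2 \<in> {0..\<sigma>}\<rbrakk>
            \<Longrightarrow> q \<le> f t u1 u2 v1 v2 / \<rho>"
    and pos: "(LINT s|lebesgue_on {\<eta>/\<alpha>..\<eta>}. (1 + \<alpha>) / (1 - \<alpha> * \<eta>) * s * (1 - s) * g s) > 0"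
    and x: "admissible \<rho> x" and y: "admissible \<sigma> y"
    and cone: "\<And>t. t \<in> {0..1} \<Longrightarrow> min t \<eta> * \<rho> \<le> x t"
  shows "\<exists>t\<in>{0..1}. slope_op x y t > \<rho>"
proof (rule ccontr)
  assume "\<not> ?thesis"
  then have le: "slope_op x y t \<le> \<rho>" if "t \<in> {0..1}" for t
    using that by force
  define a where "a = \<eta> / \<alpha>"
  have a: "0 < a" "a \<le> \<eta>" "\<eta> \<le> 1" "0 \<le> a"
    using eta_pos eta_less_1 alpha_gt_1 by (auto simp: a_def divide_le_eq)
  then have a1: "a \<in> {0..1}"
    by simp
  define I where "I t = (LINT s|lebesgue_on {a..\<eta>}. green \<eta> \<alpha> t s * g s)" for t
  define J where "J = (INF t\<in>{a..\<eta>}. I t)"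
  obtain k where k: "k > 0" "\<And>t. t \<in> {a..\<eta>} \<Longrightarrow> k \<le> I t"
    using green_integral_lower[OF pos] unfolding I_def a_def by blast
  have "k \<le> J"
    unfolding J_def using a k by (intro cINF_greatest) auto
  with k have J: "J > 0" by simp
  have JI: "J \<le> I a"
    unfolding J_def using a k by (intro cINF_lower bdd_belowI2[of _ k]) auto
  have qJ: "1 / J < q"
    using q by (simp add: M_const_def J_def I_def a_def)
  moreover have "0 < 1 / J"
    using J by simp
  ultimately have "q > 0"
    by linarith
  have adm: "admissible (max \<rho> \<sigma>) x" "admissible (max \<rho> \<sigma>) y" and R: "max \<rho> \<sigma> > 0"
    using x y assms by (auto intro: admissible_mono)
  note di = source_integrable[OF R adm]
  have "admissible \<rho> (slope_op x y)"
    using continuous_green_dt_int[OF di] le slope_op_nonneg[OF x y]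
    by (auto simp: admissible_def slope_op_def)
  from admissible_integral(3)[OF this a1]
  have up: "green_int (source x y) a \<le> \<rho>"
    by (simp add: green_int_eq_integral[OF di a1] slope_op_def)
  have "1 < q * J"
    using qJ J by (simp add: divide_less_eq)
  then have "\<rho> * 1 < \<rho> * (q * J)"
    using \<open>\<rho> > 0\<close> by (rule mult_strict_left_mono)
  then have "\<rho> < q * \<rho> * J"
    by (simp only: mult_1_right mult_ac)
  also have "\<dots> \<le> q * \<rho> * I a"
    using JI \<open>q > 0\<close> \<open>\<rho> > 0\<close> by (intro mult_left_mono) auto
  also have "\<dots> = (LINT s|lebesgue_on {a..\<eta>}. q * \<rho> * (green \<eta> \<alpha> a s * g s))"
    by (simp add: I_def)
  also have "\<dots> \<le> (LINT s|lebesgue_on {a..\<eta>}. green \<eta> \<alpha> a s * source x y s)"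
  proof (rule integral_mono_AE)
    show "integrable (lebesgue_on {a..\<eta>}) (\<lambda>s. q * \<rho> * (green \<eta> \<alpha> a s * g s))"
      using a a1 by (intro integrable_mult_right integrable_subinterval[OF _ _ integrable_green] g_integrable)
    show "integrable (lebesgue_on {a..\<eta>}) (\<lambda>s. green \<eta> \<alpha> a s * source x y s)"
      using a a1 di by (intro integrable_subinterval[OF _ _ integrable_green])
    have "AE s in lebesgue_on {a..\<eta>}. g s \<ge> 0"
      using a g_nonneg by (intro AE_subinterval[of a \<eta>])
    then show "AE s in lebesgue_on {a..\<eta>}. q * \<rho> * (green \<eta> \<alpha> a s * g s) \<le> green \<eta> \<alpha> a s * source x y s"
      using AE_space
    proof eventually_elim
      case (elim s)
      then have s: "s \<in> {\<eta>/\<alpha>..\<eta>}" "s \<in> {0..1}" "a \<le> s"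
        using a by (auto simp: a_def[symmetric])
      \<comment> \<open>Integrating \<open>x t \<ge> t * \<rho>\<close> up to \<open>a\<close> gives \<open>a\<^sup>2 / 2 * \<rho>\<close>, which is at least \<open>c * \<rho>\<close>.\<close>
      have "c_const \<eta> \<alpha> * \<rho> \<le> integral {0..s} x"
      proof -
        have hi: "((\<lambda>t. t * \<rho>) has_integral a\<^sup>2 / 2 * \<rho> - 0\<^sup>2 / 2 * \<rho>) {0..a}"
          using a by (intro fundamental_theorem_of_calculus)
            (auto intro!: derivative_eq_intros simp: has_real_derivative_iff_has_vector_derivative[symmetric])
        have "a\<^sup>2 / 2 * \<rho> = a\<^sup>2 / 2 * \<rho> - 0\<^sup>2 / 2 * \<rho>"
          by simp
        also have "\<dots> = integral {0..a} (\<lambda>t. t * \<rho>)"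
          using hi by (rule integral_unique[symmetric])
        also have "\<dots> \<le> integral {0..a} x"
        proof (rule integral_le)
          show "t * \<rho> \<le> x t" if "t \<in> {0..a}" for t
            using cone[of t] that a by auto
        qed (use admissible_integral(4)[OF x a1] in \<open>auto intro!: integrable_continuous_interval continuous_intros\<close>)
        also have "\<dots> \<le> integral {0..s} x"
          using s x admissible_integral(4)[OF x a1] admissible_integral(4)[OF x s(2)]
          by (intro integral_subset_le) (auto simp: admissible_def)
        finally have 1: "a\<^sup>2 / 2 * \<rho> \<le> integral {0..s} x" .
        have "c_const \<eta> \<alpha> = a\<^sup>2 / 2 * (min (\<alpha> - 1) 1 / (1 + \<alpha>))"
          by (simp add: c_const_def a_def power_divide)
        also have "\<dots> \<le> a\<^sup>2 / 2 * 1"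
          using alpha_gt_1 by (intro mult_left_mono) (auto simp: divide_le_eq)
        finally have "c_const \<eta> \<alpha> * \<rho> \<le> a\<^sup>2 / 2 * \<rho>"
          using \<open>\<rho> > 0\<close> by (intro mult_right_mono) auto
        with 1 show ?thesis by simp
      qed
      then have "q \<le> nemytskii f x y s / \<rho>"
        unfolding nemytskii_def
        using admissible_integral[OF x s(2)] admissible_integral[OF y s(2)] x y s
        by (intro f_ge) (auto simp: admissible_def)
      then have "q * \<rho> \<le> nemytskii f x y s"
        using \<open>\<rho> > 0\<close> by (simp add: field_simps)
      then have "(green \<eta> \<alpha> a s * g s) * (q * \<rho>) \<le> (green \<eta> \<alpha> a s * g s) * nemytskii f x y s"
        using elim green_nonneg[OF s(2) a1] by (intro mult_left_mono) auto
      then show ?case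
        by (simp add: source_def mult_ac)
    qed
  qed
  also have "\<dots> = (LINT s|unit_leb. indicator {a..\<eta>} s * (green \<eta> \<alpha> a s * source x y s))"
    using a by (intro integral_subinterval)
  also have "\<dots> \<le> green_int (source x y) a"
    unfolding green_int_def
  proof (rule integral_mono_AE)
    show gi: "integrable unit_leb (\<lambda>s. green \<eta> \<alpha> a s * source x y s)"
      using di a1 by (rule integrable_green)
    have S: "{a..\<eta>} \<in> sets unit_leb"
      using a by (subst sets_restrict_space_iff) auto
    show "integrable unit_leb (\<lambda>s. indicator {a..\<eta>} s * (green \<eta> \<alpha> a s * source x y s))"
      using integrable_mult_indicator[OF S gi] by simp
    show "AE s in unit_leb. indicator {a..\<eta>} s * (green \<eta> \<alpha> a s * source x y s) \<le> green \<eta> \<alpha> a s * source x y s"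
      using source_AE_nonneg[OF x y] AE_space
      by eventually_elim (use green_nonneg a in \<open>auto simp: indicator_def\<close>)
  qed
  finally show False
    using up by simp
qed

end

section \<open>Bounded continuous functions as states\<close>

lemma apply_Bcontfun_bounded:
  fixes h :: "'a::topological_space \<Rightarrow> real"
  assumes "continuous_on UNIV h" "\<And>t. \<bar>h t\<bar> \<le> B"
  shows "apply_bcontfun (Bcontfun h) = h"
  using assms by (intro Bcontfun_inverse bcontfun_normI) auto

lemma bcontfun_abs_le_norm: "\<bar>apply_bcontfun x t\<bar> \<le> norm x" for x :: "'a::topological_space \<Rightarrow>\<^sub>C real"
  using norm_bounded[of x t] by simp

definition clamp01 :: "real \<Rightarrow> real" where
  "clamp01 t = max 0 (min 1 t)"

lemma clamp01_simps [simp]: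
  "clamp01 t \<in> {0..1}" "0 \<le> clamp01 t" "clamp01 t \<le> 1" "t \<in> {0..1} \<Longrightarrow> clamp01 t = t"
  by (auto simp: clamp01_def)

lemma clamp01_lipschitz: "\<bar>clamp01 t - clamp01 t'\<bar> \<le> \<bar>t - t'\<bar>"
  by (auto simp: clamp01_def max_def min_def)

text \<open>
Functions on \<open>[0,1]\<close> become bounded continuous functions on the line by constant continuation, so that the space
\<open>\<real> \<Rightarrow>\<^sub>C \<real>\<close> with the supremum norm can serve as \<open>C[0,1]\<close>.
\<close>

definition extend :: "(real \<Rightarrow> real) \<Rightarrow> (real \<Rightarrow>\<^sub>C real)" where
  "extend h = Bcontfun (\<lambda>t. h (clamp01 t))"

lemma extend_apply:
  assumes "continuous_on {0..1} h"
  shows "extend h t = h (clamp01 t)"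
proof -
  have "bounded (h ` {0..1})"
    by (intro compact_imp_bounded compact_continuous_image assms compact_Icc)
  then obtain B where "\<forall>y\<in>h ` {0..1}. norm y \<le> B"
    unfolding bounded_iff by blast
  then have B: "\<bar>h t\<bar> \<le> B" if "t \<in> {0..1}" for t
    using that by simp
  have "continuous_on UNIV (\<lambda>t. h (clamp01 t))"
    by (rule continuous_on_compose2[OF assms]) (auto simp: clamp01_def intro!: continuous_intros)
  then show ?thesis
    unfolding extend_def using B by (subst apply_Bcontfun_bounded[of _ B]) auto
qed

lemma extend_tendsto:
  assumes "\<And>n. continuous_on {0..1} (h n)" "continuous_on {0..1} l"
    and "uniform_limit {0..1} h l sequentially"
  shows "(\<lambda>n. extend (h n)) \<longlonglongrightarrow> extend l"
proof (rule uniform_limit_tendsto_bcontfun, rule uniform_limitI)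
  fix e :: real assume "e > 0"
  then have "\<forall>\<^sub>F n in sequentially. \<forall>t\<in>{0..1}. dist (h n t) (l t) < e"
    using assms(3) by (auto dest: uniform_limitD)
  then show "\<forall>\<^sub>F n in sequentially. \<forall>t\<in>UNIV. dist (extend (h n) t) (extend l t) < e"
    by eventually_elim (simp add: extend_apply assms(1,2))
qed

definition unit_box :: "(real \<Rightarrow>\<^sub>C real) set" where
  "unit_box = {x :: real \<Rightarrow>\<^sub>C real. \<forall>t. 0 \<le> x t \<and> x t \<le> 1}"

lemma norm_unit_box: "x \<in> unit_box \<Longrightarrow> norm x \<le> 1"
  by (rule norm_bound) (simp add: unit_box_def)

lemma convex_unit_box: "convex unit_box"
  unfolding convex_def unit_box_def
  by (auto intro!: convex_bound_le add_nonneg_nonneg mult_nonneg_nonneg)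

definition lipschitz_box :: "real \<Rightarrow> (real \<Rightarrow>\<^sub>C real) set" where
  "lipschitz_box L = {x \<in> unit_box. (\<forall>t. x t = x (clamp01 t)) \<and> (\<forall>t t'. \<bar>x t - x t'\<bar> \<le> L * \<bar>t - t'\<bar>)}"

text \<open>
By the Arzela-Ascoli theorem on \<open>[0,1]\<close>; the functions are constant outside, so uniform convergence on \<open>[0,1]\<close> is
uniform convergence on the line.
\<close>

lemma compact_lipschitz_box: "compact (lipschitz_box L)"
proof (subst compact_eq_seq_compact_metric, rule seq_compactI)
  fix x :: "nat \<Rightarrow> real \<Rightarrow>\<^sub>C real" assume "\<forall>n. x n \<in> lipschitz_box L"
  then have x: "x n \<in> unit_box" "x n t = x n (clamp01 t)" "\<bar>x n t - x n t'\<bar> \<le> L * \<bar>t - t'\<bar>" for n t t'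
    by (auto simp: lipschitz_box_def)
  obtain h k where h: "continuous_on {0..1} h" and k: "strict_mono (k :: nat \<Rightarrow> nat)"
    and lim: "\<And>e. 0 < e \<Longrightarrow> \<exists>N. \<forall>n t. n \<ge> N \<and> t \<in> {0..1} \<longrightarrow> norm (x (k n) t - h t) < e"
  proof (rule Arzela_Ascoli[of "{0..1}" "\<lambda>n. apply_bcontfun (x n)" 1])
    show "norm (x n t) \<le> 1" for n t
      using x(1)[of n] by (simp add: unit_box_def)
    fix t e :: real assume "0 < e"
    have "\<bar>x n t - x n t'\<bar> < e" if "\<bar>t - t'\<bar> < e / (\<bar>L\<bar> + 1)" for n t'
    proof -
      have "\<bar>x n t - x n t'\<bar> \<le> (\<bar>L\<bar> + 1) * \<bar>t - t'\<bar>"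
        using x(3)[of n t t'] mult_right_mono[of L "\<bar>L\<bar> + 1" "\<bar>t - t'\<bar>"] by linarith
      also have "\<dots> < e"
        using that by (simp add: pos_less_divide_eq mult.commute add_nonneg_pos)
      finally show ?thesis .
    qed
    then show "\<exists>d. 0 < d \<and> (\<forall>n y. y \<in> {0..1} \<and> norm (t - y) < d \<longrightarrow> norm (x n t - x n y) < e)"
      using \<open>0 < e\<close> by (intro exI[of _ "e / (\<bar>L\<bar> + 1)"]) (auto simp: add_nonneg_pos)
  qed auto
  have "(\<lambda>n. x (k n)) \<longlonglongrightarrow> extend h"
  proof (rule uniform_limit_tendsto_bcontfun, rule uniform_limitI)
    fix e :: real assume "e > 0"
    then obtain N where N: "\<And>n t. n \<ge> N \<Longrightarrow> t \<in> {0..1} \<Longrightarrow> norm (x (k n) t - h t) < e"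
      using lim by blast
    have "dist (x (k n) t) (extend h t) < e" if "n \<ge> N" for n t
      using N[OF that, of "clamp01 t"] x(2)[of "k n" t] by (simp add: extend_apply[OF h] dist_norm)
    then show "\<forall>\<^sub>F n in sequentially. \<forall>t\<in>UNIV. dist (x (k n) t) (extend h t) < e"
      unfolding eventually_sequentially by blast
  qed
  note conv = this
  have pt: "(\<lambda>n. x (k n) t) \<longlonglongrightarrow> extend h t" for t
    by (rule tendsto_uniform_limitI[OF tendsto_bcontfun_uniform_limit[OF conv]]) simp
  have "extend h \<in> lipschitz_box L"
    unfolding lipschitz_box_def unit_box_def
  proof (intro CollectI conjI allI)
    fix t t' :: real
    show "0 \<le> extend h t"
      using x(1) by (intro LIMSEQ_le_const[OF pt]) (auto simp: unit_box_def)
    show "extend h t \<le> 1"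
      using x(1) by (intro LIMSEQ_le_const2[OF pt]) (auto simp: unit_box_def)
    show "extend h t = extend h (clamp01 t)"
      by (simp add: extend_apply[OF h])
    have "(\<lambda>n. \<bar>x (k n) t - x (k n) t'\<bar>) \<longlonglongrightarrow> \<bar>extend h t - extend h t'\<bar>"
      by (intro tendsto_intros pt)
    then show "\<bar>extend h t - extend h t'\<bar> \<le> L * \<bar>t - t'\<bar>"
      using x(3) by (intro LIMSEQ_le_const2) auto
  qed
  with conv k show "\<exists>l\<in>lipschitz_box L. \<exists>r. strict_mono r \<and> (x \<circ> r) \<longlonglongrightarrow> l"
    by (auto simp: o_def)
qed

lemma nonexpansive_imp_continuous:
  assumes "\<And>x y. dist (f x) (f y) \<le> dist x y"
  shows "continuous_on S f"
  unfolding continuous_on_iff using assms by (meson le_less_trans)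

lemma continuous_const_bcontfun: "continuous_on S (const_bcontfun :: real \<Rightarrow> (real \<Rightarrow>\<^sub>C real))"
  by (rule nonexpansive_imp_continuous, rule dist_bound) (simp add: const_bcontfun.rep_eq)

definition cut :: "(real \<Rightarrow>\<^sub>C real) \<Rightarrow> (real \<Rightarrow>\<^sub>C real)" where
  "cut x = Bcontfun (\<lambda>t. min 1 (apply_bcontfun x t))"

lemma cut_apply [simp]: "cut x t = min 1 (x t)"
proof -
  have "\<bar>min 1 (x t)\<bar> \<le> max 1 (norm x)" for t
    using bcontfun_abs_le_norm[of x t] by (auto simp: min_def max_def)
  then show ?thesis
    unfolding cut_def by (subst apply_Bcontfun_bounded) (auto intro!: continuous_intros)
qed

lemma continuous_cut: "continuous_on S cut"
proof (rule nonexpansive_imp_continuous, rule dist_bound)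
  fix x y :: "real \<Rightarrow>\<^sub>C real" and t
  show "dist (cut x t) (cut y t) \<le> dist x y"
    using dist_bounded[of x t y] by (auto simp: dist_real_def min_def)
qed

text \<open>
On nonnegative functions this is a norm-preserving retraction onto the cone. The weight \<open>max 0 (min t \<eta>)\<close> extends \<open>min t \<eta>\<close>
to a continuous function with values in \<open>[0,1]\<close> on the whole line; values in \<open>[0,1]\<close> make the map nonexpansive.
\<close>

definition cone_lift :: "real \<Rightarrow> (real \<Rightarrow>\<^sub>C real) \<Rightarrow> (real \<Rightarrow>\<^sub>C real)" where
  "cone_lift \<eta> x = Bcontfun (\<lambda>t. max (x t) (max 0 (min t \<eta>) * norm x))"

lemma cone_lift_apply:
  assumes "0 \<le> \<eta>" "\<eta> \<le> 1"
  shows "cone_lift \<eta> x t = max (x t) (max 0 (min t \<eta>) * norm x)"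
proof -
  have "\<bar>max (x t) (max 0 (min t \<eta>) * norm x)\<bar> \<le> norm x" for t
  proof -
    have "max 0 (min t \<eta>) * norm x \<le> 1 * norm x"
      using assms by (intro mult_right_mono) auto
    moreover have "0 \<le> max 0 (min t \<eta>) * norm x"
      by simp
    ultimately show ?thesis
      using bcontfun_abs_le_norm[of x t] by (auto simp: abs_le_iff max_def)
  qed
  then show ?thesis
    unfolding cone_lift_def by (subst apply_Bcontfun_bounded) (auto intro!: continuous_intros)
qed

lemma continuous_cone_lift:
  assumes "0 \<le> \<eta>" "\<eta> \<le> 1"
  shows "continuous_on S (cone_lift \<eta>)"
proof (rule nonexpansive_imp_continuous, rule dist_bound)
  fix x y :: "real \<Rightarrow>\<^sub>C real" and t
  define c where "c = max 0 (min t \<eta>)"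
  have c: "0 \<le> c" "c \<le> 1"
    using assms by (auto simp: c_def)
  have "\<bar>c * norm x - c * norm y\<bar> = c * \<bar>norm x - norm y\<bar>"
    using c by (simp add: abs_mult right_diff_distrib[symmetric])
  also have "\<dots> \<le> 1 * dist x y"
    using c norm_triangle_ineq3[of x y] by (intro mult_mono) (auto simp: dist_norm)
  finally have "\<bar>c * norm x - c * norm y\<bar> \<le> dist x y"
    by simp
  moreover have "\<bar>x t - y t\<bar> \<le> dist x y"
    using dist_bounded[of x t y] by (simp add: dist_real_def)
  ultimately show "dist (cone_lift \<eta> x t) (cone_lift \<eta> y t) \<le> dist x y"
    unfolding cone_lift_apply[OF assms] c_def[symmetric] dist_real_def by (auto simp: max_def)
qed

text \<open>
For nonnegative \<open>x\<close>, and before the scaling by \<open>\<beta>\<close>, the norm becomes \<open>norm x + 1 - p\<close>. If \<open>p\<close> is the larger of the norms of two components,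
the larger norm therefore becomes exactly \<open>1\<close>, even at the origin, where dividing by the norm would fail. Nonnegative constants lie in the
cone, so the result does too.
\<close>

definition push :: "real \<Rightarrow> real \<Rightarrow> real \<Rightarrow> (real \<Rightarrow>\<^sub>C real) \<Rightarrow> (real \<Rightarrow>\<^sub>C real)" where
  "push \<eta> \<beta> p x = \<beta> *\<^sub>R (cone_lift \<eta> x + const_bcontfun (1 - p))"

lemma push_apply:
  assumes "0 \<le> \<eta>" "\<eta> \<le> 1"
  shows "push \<eta> \<beta> p x t = \<beta> * (max (x t) (max 0 (min t \<eta>) * norm x) + (1 - p))"
  by (simp add: push_def cone_lift_apply[OF assms] const_bcontfun.rep_eq)

lemma push_admissible:
  assumes "0 \<le> \<eta>" "\<eta> \<le> 1" "x \<in> unit_box" "norm x \<le> p" "p \<le> 1" "0 < \<beta>"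
  shows "admissible \<beta> (push \<eta> \<beta> p x)"
  unfolding admissible_def
proof (intro conjI ballI)
  fix t :: real
  define m where "m = max (x t) (max 0 (min t \<eta>) * norm x)"
  have "max 0 (min t \<eta>) * norm x \<le> 1 * norm x"
    using assms by (intro mult_right_mono) auto
  then have "m \<le> p" "0 \<le> m"
    using assms(3,4) bcontfun_abs_le_norm[of x t] by (auto simp: m_def unit_box_def le_max_iff_disj)
  then have "0 \<le> m + (1 - p)" "m + (1 - p) \<le> 1"
    using assms by auto
  then show "0 \<le> push \<eta> \<beta> p x t" "push \<eta> \<beta> p x t \<le> \<beta>"
    using \<open>0 < \<beta>\<close> mult_left_mono[of "m + (1 - p)" 1 \<beta>] by (auto simp: push_apply[OF assms(1,2)] m_def[symmetric])
qed simp

text \<open>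
The case in which \<open>x\<close> is the component of larger norm, which is the component that the push moves to norm \<open>1\<close>.
\<close>

lemma push_cone:
  assumes "0 \<le> \<eta>" "\<eta> \<le> 1" "0 < \<beta>" "norm x \<le> 1" "t \<in> {0..1}"
  shows "min t \<eta> * \<beta> \<le> push \<eta> \<beta> (norm x) x t"
proof -
  define k where "k = max 0 (min t \<eta>)"
  have k: "k = min t \<eta>" "0 \<le> k" "k \<le> 1"
    using assms by (auto simp: k_def)
  have "k \<le> k * norm x + (1 - norm x)"
    using mult_right_mono[of k 1 "1 - norm x"] k assms(4) by (simp add: algebra_simps)
  also have "\<dots> \<le> max (x t) (k * norm x) + (1 - norm x)"
    by simp
  finally have "\<beta> * k \<le> push \<eta> \<beta> (norm x) x t"
    unfolding push_apply[OF assms(1,2)] k_def using \<open>0 < \<beta>\<close> by (intro mult_left_mono) auto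
  then show ?thesis
    by (simp add: k mult.commute)
qed

section \<open>A nontrivial fixed point of a system of cone operators\<close>

text \<open>
The properties of \<open>slope_op\<close> on which the fixed point argument rests; the first argument is the component determined by the equation.
\<close>

locale cone_operator =
  fixes \<eta> :: real and T :: "(real \<Rightarrow> real) \<Rightarrow> (real \<Rightarrow> real) \<Rightarrow> real \<Rightarrow> real"
  assumes eta: "0 < \<eta>" "\<eta> \<le> 1"
    and nonneg: "\<And>R x y t. admissible R x \<Longrightarrow> admissible R y \<Longrightarrow> t \<in> {0..1} \<Longrightarrow> 0 \<le> T x y t"
    and cone: "\<And>R x y t t'. R > 0 \<Longrightarrow> admissible R x \<Longrightarrow> admissible R y \<Longrightarrow> t \<in> {0..1} \<Longrightarrow> t' \<in> {0..1}
        \<Longrightarrow> min t \<eta> * T x y t' \<le> T x y t"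
    and lipschitz: "\<And>R. R > 0 \<Longrightarrow> \<exists>L\<ge>0. \<forall>x y. \<forall>t\<in>{0..1}. \<forall>t'\<in>{0..1}. admissible R x \<longrightarrow> admissible R y
        \<longrightarrow> \<bar>T x y t - T x y t'\<bar> \<le> L * \<bar>t - t'\<bar>"
    and limit: "\<And>R xn x yn y. R > 0 \<Longrightarrow> (\<And>n. admissible R (xn n)) \<Longrightarrow> admissible R x \<Longrightarrow> (\<And>n. admissible R (yn n)) \<Longrightarrow> admissible R y
        \<Longrightarrow> uniform_limit {0..1} xn x sequentially \<Longrightarrow> uniform_limit {0..1} yn y sequentially
        \<Longrightarrow> uniform_limit {0..1} (\<lambda>n. T (xn n) (yn n)) (T x y) sequentially"
begin

lemma continuous_T:
  assumes "R > 0" "admissible R x" "admissible R y"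
  shows "continuous_on {0..1} (T x y)"
proof -
  obtain L where "L \<ge> 0" "\<forall>t\<in>{0..1}. \<forall>t'\<in>{0..1}. \<bar>T x y t - T x y t'\<bar> \<le> L * \<bar>t - t'\<bar>"
    using lipschitz[OF assms(1)] assms(2,3) by blast
  then have "L-lipschitz_on {0..1} (T x y)"
    by (intro lipschitz_onI) (auto simp: dist_real_def)
  then show ?thesis
    by (rule lipschitz_on_continuous_on)
qed

definition rescaled :: "real \<Rightarrow> (real \<Rightarrow>\<^sub>C real) \<Rightarrow> (real \<Rightarrow>\<^sub>C real) \<Rightarrow> (real \<Rightarrow>\<^sub>C real)" where
  "rescaled \<beta> x y = (1 / \<beta>) *\<^sub>R extend (T x y)"

lemma rescaled_apply:
  assumes "R > 0" "admissible R (apply_bcontfun x)" "admissible R (apply_bcontfun y)"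
  shows "rescaled \<beta> x y t = T x y (clamp01 t) / \<beta>"
  by (simp add: rescaled_def extend_apply[OF continuous_T[OF assms]])

lemma continuous_rescaled:
  fixes S :: "'w::metric_space set"
  assumes "R > 0" and "continuous_on S b" "continuous_on S x" "continuous_on S y"
    and "\<And>w. w \<in> S \<Longrightarrow> b w \<noteq> 0" and adm: "\<And>w. w \<in> S \<Longrightarrow> admissible R (apply_bcontfun (x w))"
    "\<And>w. w \<in> S \<Longrightarrow> admissible R (apply_bcontfun (y w))"
  shows "continuous_on S (\<lambda>w. rescaled (b w) (x w) (y w))"
  unfolding rescaled_def
proof (intro continuous_intros assms ballI)
  show "continuous_on S (\<lambda>w. extend (T (x w) (y w)))"
    unfolding continuous_on_sequentially o_def
  proof safe
    fix v and w assume w: "w \<in> S" and v: "\<forall>n. v n \<in> S" and lim: "v \<longlonglongrightarrow> w"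
    have "(\<lambda>n. x (v n)) \<longlonglongrightarrow> x w" "(\<lambda>n. y (v n)) \<longlonglongrightarrow> y w"
      using v w by (auto intro!: continuous_on_tendsto_compose[OF _ lim] assms)
    then have "uniform_limit {0..1} (\<lambda>n. apply_bcontfun (x (v n))) (x w) sequentially"
      "uniform_limit {0..1} (\<lambda>n. apply_bcontfun (y (v n))) (y w) sequentially"
      by (auto intro: uniform_limit_on_subset[OF tendsto_bcontfun_uniform_limit])
    then have "uniform_limit {0..1} (\<lambda>n. T (x (v n)) (y (v n))) (T (x w) (y w)) sequentially"
      using v w by (intro limit[OF \<open>R > 0\<close>] adm) auto
    then show "(\<lambda>n. extend (T (x (v n)) (y (v n)))) \<longlonglongrightarrow> extend (T (x w) (y w))"
      using v w by (intro extend_tendsto continuous_T[OF \<open>R > 0\<close>] adm) auto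
  qed
qed

lemma rescaled_in_lipschitz_box:
  assumes "R > 0" "m > 0"
  obtains L where "\<And>\<beta> x y. m \<le> \<beta> \<Longrightarrow> admissible R (apply_bcontfun x) \<Longrightarrow> admissible R (apply_bcontfun y)
    \<Longrightarrow> cut (rescaled \<beta> x y) \<in> lipschitz_box L"
proof -
  obtain L where L: "L \<ge> 0" "\<And>x y t t'. admissible R x \<Longrightarrow> admissible R y \<Longrightarrow> t \<in> {0..1} \<Longrightarrow> t' \<in> {0..1}
      \<Longrightarrow> \<bar>T x y t - T x y t'\<bar> \<le> L * \<bar>t - t'\<bar>"
    using lipschitz[OF assms(1)] by blast
  show thesis
  proof (rule that)
    fix \<beta> and x y :: "real \<Rightarrow>\<^sub>C real"
    assume \<beta>: "m \<le> \<beta>" and adm: "admissible R (apply_bcontfun x)" "admissible R (apply_bcontfun y)"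
    note ap = rescaled_apply[OF \<open>R > 0\<close> adm]
    show "cut (rescaled \<beta> x y) \<in> lipschitz_box (L / m)"
      unfolding lipschitz_box_def unit_box_def
    proof (intro CollectI conjI allI)
      fix t t' :: real
      show "0 \<le> cut (rescaled \<beta> x y) t"
        using nonneg[OF adm, of "clamp01 t"] \<beta> \<open>m > 0\<close> by (simp add: ap)
      show "cut (rescaled \<beta> x y) t \<le> 1" "cut (rescaled \<beta> x y) t = cut (rescaled \<beta> x y) (clamp01 t)"
        by (simp_all add: ap)
      have "\<bar>cut (rescaled \<beta> x y) t - cut (rescaled \<beta> x y) t'\<bar> \<le> \<bar>rescaled \<beta> x y t - rescaled \<beta> x y t'\<bar>"
        by (auto simp: min_def)
      also have "\<dots> = \<bar>T x y (clamp01 t) - T x y (clamp01 t')\<bar> / \<beta>"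
        using \<beta> \<open>m > 0\<close> by (simp add: ap abs_divide diff_divide_distrib[symmetric])
      also have "\<dots> \<le> (L * \<bar>t - t'\<bar>) / m"
      proof (rule frac_le)
        have "\<bar>T x y (clamp01 t) - T x y (clamp01 t')\<bar> \<le> L * \<bar>clamp01 t - clamp01 t'\<bar>"
          by (rule L(2)[OF adm]) auto
        also have "\<dots> \<le> L * \<bar>t - t'\<bar>"
          using L(1) clamp01_lipschitz by (rule mult_left_mono[rotated])
        finally show "\<bar>T x y (clamp01 t) - T x y (clamp01 t')\<bar> \<le> L * \<bar>t - t'\<bar>" .
      qed (use L(1) \<beta> \<open>m > 0\<close> in auto)
      finally show "\<bar>cut (rescaled \<beta> x y) t - cut (rescaled \<beta> x y) t'\<bar> \<le> L / m * \<bar>t - t'\<bar>"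
        by simp
    qed
  qed
qed

lemma norm_rescaled_le:
  assumes "R > 0" "admissible R (apply_bcontfun x)" "admissible R (apply_bcontfun y)" "\<beta> > 0" "0 \<le> \<theta>"
    "\<And>t. t \<in> {0..1} \<Longrightarrow> T x y t \<le> \<theta> * \<beta>"
  shows "norm (rescaled \<beta> x y) \<le> \<theta>"
proof (rule norm_bound)
  fix t
  show "norm (rescaled \<beta> x y t) \<le> \<theta>"
    using assms(4) assms(6)[of "clamp01 t"] nonneg[OF assms(2,3), of "clamp01 t"]
    by (simp add: rescaled_apply[OF assms(1-3)] pos_divide_le_eq)
qed

lemma norm_rescaled_greater:
  assumes "R > 0" "admissible R (apply_bcontfun x)" "admissible R (apply_bcontfun y)" "\<beta> > 0"
    "t \<in> {0..1}" "\<beta> < T x y t"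
  shows "1 < norm (rescaled \<beta> x y)"
proof -
  have "1 < rescaled \<beta> x y t"
    using assms(4-6) by (simp add: rescaled_apply[OF assms(1-3)])
  also have "\<dots> \<le> norm (rescaled \<beta> x y)"
    using bcontfun_abs_le_norm[of "rescaled \<beta> x y" t] by simp
  finally show ?thesis .
qed

text \<open>
The image of the operator lies in the cone, so the lift does not change it and a push with \<open>p = 1\<close> only restores the scale.
\<close>

lemma push_rescaled:
  assumes "R > 0" "admissible R (apply_bcontfun x)" "admissible R (apply_bcontfun y)" "\<beta> > 0" "t \<in> {0..1}"
  shows "push \<eta> \<beta> 1 (rescaled \<beta> x y) t = T x y t"
proof -
  define w where "w = rescaled \<beta> x y"
  have w: "w t = T x y (clamp01 t) / \<beta>" for t
    by (simp add: w_def rescaled_apply[OF assms(1-3)])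
  define k where "k = min t \<eta>"
  have k: "0 \<le> k"
    using eta assms(5) by (simp add: k_def)
  have w0: "0 \<le> w t" for t
    using nonneg[OF assms(2,3), of "clamp01 t"] assms(4) by (simp add: w)
  have kw: "k * w t' \<le> w t" for t'
    using cone[OF assms(1-3,5), of "clamp01 t'"] assms(4,5) by (simp add: w k_def divide_right_mono)
  have "k * norm w \<le> w t"
  proof (cases "k = 0")
    case False
    with k have "k > 0" by simp
    have "norm w \<le> w t / k"
    proof (rule norm_bound)
      fix t'
      show "norm (w t') \<le> w t / k"
        using kw[of t'] w0[of t'] \<open>k > 0\<close> by (simp add: pos_le_divide_eq mult.commute)
    qed
    with \<open>k > 0\<close> show ?thesis
      by (simp add: pos_le_divide_eq mult.commute)
  qed (use w0 in simp)
  then have "push \<eta> \<beta> 1 w t = \<beta> * w t"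
    using eta k by (simp add: push_apply k_def[symmetric])
  also have "\<dots> = T x y t"
    using assms(4,5) by (simp add: w)
  finally show ?thesis
    by (simp add: w_def)
qed

end

text \<open>
Contraction of the box with sides \<open>a1\<close>, \<open>a2\<close> and expansion at the boundary of the box with sides \<open>b1\<close>, \<open>b2\<close>.
\<close>

locale cone_system = A: cone_operator \<eta>1 T1 + B: cone_operator \<eta>2 T2
  for \<eta>1 \<eta>2 :: real and T1 T2 +
  fixes a1 a2 b1 b2 :: real
  assumes pos: "a1 > 0" "a2 > 0" "b1 > 0" "b2 > 0"
    and contracts1: "\<exists>\<theta><1. \<forall>x y. \<forall>t\<in>{0..1}. admissible a1 x \<longrightarrow> admissible a2 y \<longrightarrow> T1 x y t \<le> \<theta> * a1"
    and contracts2: "\<exists>\<theta><1. \<forall>y x. \<forall>t\<in>{0..1}. admissible a2 y \<longrightarrow> admissible a1 x \<longrightarrow> T2 y x t \<le> \<theta> * a2"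
    and leaves1: "\<And>x y. admissible b1 x \<Longrightarrow> admissible b2 y \<Longrightarrow> \<forall>t\<in>{0..1}. min t \<eta>1 * b1 \<le> x t \<Longrightarrow> \<exists>t\<in>{0..1}. b1 < T1 x y t"
    and leaves2: "\<And>x y. admissible b2 y \<Longrightarrow> admissible b1 x \<Longrightarrow> \<forall>t\<in>{0..1}. min t \<eta>2 * b2 \<le> y t \<Longrightarrow> \<exists>t\<in>{0..1}. b2 < T2 y x t"
begin

definition outer :: real where "outer = max (max a1 a2) (max b1 b2)"
definition inner :: real where "inner = min (min a1 a2) (min b1 b2)"
definition side1 :: "real \<Rightarrow> real" where "side1 \<tau> = (1 - \<tau>) * a1 + \<tau> * b1"
definition side2 :: "real \<Rightarrow> real" where "side2 \<tau> = (1 - \<tau>) * a2 + \<tau> * b2"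

definition pair_norm :: "(real \<Rightarrow>\<^sub>C real) \<Rightarrow> (real \<Rightarrow>\<^sub>C real) \<Rightarrow> real" where
  "pair_norm x y = max (norm x) (norm y)"

definition arg1 where "arg1 x y \<tau> = push \<eta>1 (side1 \<tau>) (pair_norm x y) x"
definition arg2 where "arg2 x y \<tau> = push \<eta>2 (side2 \<tau>) (pair_norm x y) y"
definition image1 where "image1 x y \<tau> = A.rescaled (side1 \<tau>) (arg1 x y \<tau>) (arg2 x y \<tau>)"
definition image2 where "image2 x y \<tau> = B.rescaled (side2 \<tau>) (arg2 x y \<tau>) (arg1 x y \<tau>)"

text \<open>
The third component increases \<open>\<tau>\<close> if the rescaled image has norm below \<open>1\<close> and decreases it if the norm is above \<open>1\<close>. By the
contraction at \<open>\<tau> = 0\<close> and the expansion at \<open>\<tau> = 1\<close>, it moves \<open>\<tau>\<close> away from both ends.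
\<close>

definition flow_map where
  "flow_map w = (case w of (x, y, \<tau>) \<Rightarrow>
     (cut (image1 x y \<tau>), cut (image2 x y \<tau>), clamp01 (\<tau> + 1 - pair_norm (image1 x y \<tau>) (image2 x y \<tau>))))"

lemma radii_pos: "outer > 0" "inner > 0"
  using pos by (auto simp: outer_def inner_def)

lemma side_bounds:
  assumes "\<tau> \<in> {0..1}"
  shows "inner \<le> side1 \<tau>" "inner \<le> side2 \<tau>" "side1 \<tau> \<le> outer" "side2 \<tau> \<le> outer" "side1 \<tau> > 0" "side2 \<tau> > 0"
proof -
  have *: "inner \<le> (1 - \<tau>) * a + \<tau> * b" "(1 - \<tau>) * a + \<tau> * b \<le> outer"
    if "inner \<le> a" "inner \<le> b" "a \<le> outer" "b \<le> outer" for a b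
  proof -
    have "(1 - \<tau>) * inner + \<tau> * inner \<le> (1 - \<tau>) * a + \<tau> * b" "(1 - \<tau>) * a + \<tau> * b \<le> (1 - \<tau>) * outer + \<tau> * outer"
      using assms that by (auto intro!: add_mono mult_left_mono)
    then show "inner \<le> (1 - \<tau>) * a + \<tau> * b" "(1 - \<tau>) * a + \<tau> * b \<le> outer"
      by (simp_all add: algebra_simps)
  qed
  show "inner \<le> side1 \<tau>" "inner \<le> side2 \<tau>" "side1 \<tau> \<le> outer" "side2 \<tau> \<le> outer"
    unfolding side1_def side2_def by (rule *; simp add: inner_def outer_def)+
  then show "side1 \<tau> > 0" "side2 \<tau> > 0"
    using radii_pos by linarith+
qed

definition state :: "((real \<Rightarrow>\<^sub>C real) \<times> (real \<Rightarrow>\<^sub>C real) \<times> real) set" where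
  "state = unit_box \<times> unit_box \<times> {0..1}"

lemma arg_admissible:
  assumes "x \<in> unit_box" "y \<in> unit_box" "\<tau> \<in> {0..1}"
  shows "admissible (side1 \<tau>) (apply_bcontfun (arg1 x y \<tau>))" "admissible (side2 \<tau>) (apply_bcontfun (arg2 x y \<tau>))"
  unfolding arg1_def arg2_def
  using assms side_bounds[OF assms(3)] norm_unit_box[OF assms(1)] norm_unit_box[OF assms(2)] A.eta B.eta
  by (auto intro!: push_admissible simp: pair_norm_def)

lemma arg_admissible_outer:
  assumes "x \<in> unit_box" "y \<in> unit_box" "\<tau> \<in> {0..1}"
  shows "admissible outer (apply_bcontfun (arg1 x y \<tau>))" "admissible outer (apply_bcontfun (arg2 x y \<tau>))"
  using arg_admissible[OF assms] side_bounds[OF assms(3)] by (auto intro: admissible_mono)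

lemma continuous_flow_map: "continuous_on state flow_map"
proof -
  have pn: "continuous_on state (\<lambda>w. pair_norm (x w) (y w))" if "continuous_on state x" "continuous_on state y" for x y
    unfolding pair_norm_def using that by (intro continuous_intros)
  have b: "continuous_on state (\<lambda>w. side1 (snd (snd w)))" "continuous_on state (\<lambda>w. side2 (snd (snd w)))"
    unfolding side1_def side2_def by (intro continuous_intros)+
  have z: "continuous_on state (\<lambda>w. arg1 (fst w) (fst (snd w)) (snd (snd w)))"
    "continuous_on state (\<lambda>w. arg2 (fst w) (fst (snd w)) (snd (snd w)))"
    unfolding arg1_def arg2_def push_def using A.eta B.eta
    by (auto intro!: continuous_intros b pn continuous_on_compose2[OF continuous_cone_lift[of _ UNIV]]
        continuous_on_compose2[OF continuous_const_bcontfun[of UNIV]])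
  have adm: "admissible outer (apply_bcontfun (arg1 (fst w) (fst (snd w)) (snd (snd w))))"
      "admissible outer (apply_bcontfun (arg2 (fst w) (fst (snd w)) (snd (snd w))))"
      "side1 (snd (snd w)) \<noteq> 0" "side2 (snd (snd w)) \<noteq> 0" if "w \<in> state" for w
    using that arg_admissible_outer[of "fst w" "fst (snd w)" "snd (snd w)"] side_bounds[of "snd (snd w)"]
    by (auto simp: state_def)
  have o: "continuous_on state (\<lambda>w. image1 (fst w) (fst (snd w)) (snd (snd w)))"
    "continuous_on state (\<lambda>w. image2 (fst w) (fst (snd w)) (snd (snd w)))"
    unfolding image1_def image2_def
    by (intro A.continuous_rescaled[OF radii_pos(1)] B.continuous_rescaled[OF radii_pos(1)] b z adm; assumption)+
  show ?thesis
    unfolding flow_map_def case_prod_beta clamp01_def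
    by (intro continuous_on_Pair continuous_intros pn o continuous_on_compose2[OF continuous_cut[of UNIV]]) auto
qed

lemma flow_map_compact_range:
  obtains K where "compact K" "K \<subseteq> state" "\<And>w. w \<in> state \<Longrightarrow> flow_map w \<in> K"
proof -
  obtain L1 where L1: "\<And>\<beta> x y. inner \<le> \<beta> \<Longrightarrow> admissible outer (apply_bcontfun x) \<Longrightarrow> admissible outer (apply_bcontfun y)
      \<Longrightarrow> cut (A.rescaled \<beta> x y) \<in> lipschitz_box L1"
    using A.rescaled_in_lipschitz_box[OF radii_pos] by blast
  obtain L2 where L2: "\<And>\<beta> x y. inner \<le> \<beta> \<Longrightarrow> admissible outer (apply_bcontfun x) \<Longrightarrow> admissible outer (apply_bcontfun y)
      \<Longrightarrow> cut (B.rescaled \<beta> x y) \<in> lipschitz_box L2"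
    using B.rescaled_in_lipschitz_box[OF radii_pos] by blast
  show thesis
  proof (rule that)
    show "compact (lipschitz_box L1 \<times> lipschitz_box L2 \<times> {0..1::real})"
      by (intro compact_Times compact_lipschitz_box compact_Icc)
    show "lipschitz_box L1 \<times> lipschitz_box L2 \<times> {0..1} \<subseteq> state"
      by (auto simp: state_def lipschitz_box_def)
    fix w assume "w \<in> state"
    then show "flow_map w \<in> lipschitz_box L1 \<times> lipschitz_box L2 \<times> {0..1}"
      by (auto simp: state_def flow_map_def image1_def image2_def intro!: L1 L2 side_bounds arg_admissible_outer)
  qed
qed

text \<open>
At \<open>\<tau> = 0\<close> the rescaled image has norm \<open>p < 1\<close> and \<open>\<tau>\<close> would increase, at \<open>\<tau> = 1\<close> it has \<open>p > 1\<close> and \<open>\<tau>\<close> would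
decrease. A fixed point therefore has \<open>p = 1\<close>; then nothing is truncated, the shape has norm \<open>1\<close>, and pushing it only
rescales it.
\<close>

theorem nontrivial_fixed_point:
  obtains x y where "admissible outer x" "admissible outer y"
    "\<forall>t\<in>{0..1}. x t = T1 x y t" "\<forall>t\<in>{0..1}. y t = T2 y x t"
    "\<exists>t\<in>{0..1}. x t \<noteq> 0 \<or> y t \<noteq> 0"
proof -
  obtain K where K: "compact K" "K \<subseteq> state" "\<And>w. w \<in> state \<Longrightarrow> flow_map w \<in> K"
    using flow_map_compact_range by blast
  have "0 \<in> unit_box"
    by (simp add: unit_box_def)
  then have "convex state" "state \<noteq> {}"
    unfolding state_def by (auto intro!: convex_Times convex_unit_box)
  then obtain w where "w \<in> state" "flow_map w = w"
    using schauder_fixed_point[OF _ _ continuous_flow_map K(3) K(1,2)] by blast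
  then obtain x y \<tau> where xy: "x \<in> unit_box" "y \<in> unit_box" and \<tau>: "\<tau> \<in> {0..1}"
    and fx: "cut (image1 x y \<tau>) = x" and fy: "cut (image2 x y \<tau>) = y"
    and ft: "clamp01 (\<tau> + 1 - pair_norm (image1 x y \<tau>) (image2 x y \<tau>)) = \<tau>"
    by (cases w) (auto simp: state_def flow_map_def)
  note adm = arg_admissible[OF xy \<tau>] and admR = arg_admissible_outer[OF xy \<tau>] and b = side_bounds[OF \<tau>]
  note n1 = norm_unit_box[OF xy(1)] and n2 = norm_unit_box[OF xy(2)]
  define p where "p = pair_norm (image1 x y \<tau>) (image2 x y \<tau>)"
  have fp: "clamp01 (\<tau> + 1 - p) = \<tau>"
    using ft by (simp add: p_def)
  have "\<tau> \<noteq> 0"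
  proof
    assume "\<tau> = 0"
    then have beta: "side1 \<tau> = a1" "side2 \<tau> = a2"
      by (simp_all add: side1_def side2_def)
    obtain \<theta>1 where \<theta>1: "\<theta>1 \<ge> 0" "\<theta>1 < 1" "\<forall>t\<in>{0..1}. T1 (arg1 x y \<tau>) (arg2 x y \<tau>) t \<le> \<theta>1 * a1"
    proof -
      obtain \<theta> where "\<theta> < 1" "\<forall>t\<in>{0..1}. T1 (arg1 x y \<tau>) (arg2 x y \<tau>) t \<le> \<theta> * a1"
        using contracts1 adm beta by metis
      moreover have "\<theta> * a1 \<le> max 0 \<theta> * a1"
        using pos by (intro mult_right_mono) auto
      ultimately show thesis
        by (intro that[of "max 0 \<theta>"]) force+
    qed
    obtain \<theta>2 where \<theta>2: "\<theta>2 \<ge> 0" "\<theta>2 < 1" "\<forall>t\<in>{0..1}. T2 (arg2 x y \<tau>) (arg1 x y \<tau>) t \<le> \<theta>2 * a2"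
    proof -
      obtain \<theta> where "\<theta> < 1" "\<forall>t\<in>{0..1}. T2 (arg2 x y \<tau>) (arg1 x y \<tau>) t \<le> \<theta> * a2"
        using contracts2 adm beta by metis
      moreover have "\<theta> * a2 \<le> max 0 \<theta> * a2"
        using pos by (intro mult_right_mono) auto
      ultimately show thesis
        by (intro that[of "max 0 \<theta>"]) force+
    qed
    have "norm (image1 x y \<tau>) \<le> \<theta>1"
      unfolding image1_def using \<theta>1 pos beta by (intro A.norm_rescaled_le[OF radii_pos(1) admR]) auto
    moreover have "norm (image2 x y \<tau>) \<le> \<theta>2"
      unfolding image2_def using \<theta>2 pos beta by (intro B.norm_rescaled_le[OF radii_pos(1) admR(2,1)]) auto
    ultimately have "p < 1"
      using \<theta>1 \<theta>2 by (simp add: p_def pair_norm_def)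
    with fp \<open>\<tau> = 0\<close> show False
      by (simp add: clamp01_def min_def max_def split: if_splits)
  qed
  moreover have "\<tau> \<noteq> 1"
  proof
    assume "\<tau> = 1"
    then have beta: "side1 \<tau> = b1" "side2 \<tau> = b2"
      by (simp_all add: side1_def side2_def)
    have "1 < p"
    proof (cases "norm x \<ge> norm y")
      case True
      then have "arg1 x y \<tau> = push \<eta>1 b1 (norm x) x"
        by (simp add: arg1_def pair_norm_def beta)
      then have "\<forall>t\<in>{0..1}. min t \<eta>1 * b1 \<le> arg1 x y \<tau> t"
        using push_cone[of \<eta>1 b1 x] A.eta pos n1 by auto
      then obtain t where "t \<in> {0..1}" "b1 < T1 (arg1 x y \<tau>) (arg2 x y \<tau>) t"
        using leaves1 adm beta by metis
      then have "1 < norm (image1 x y \<tau>)"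
        unfolding image1_def beta using pos by (intro A.norm_rescaled_greater[OF radii_pos(1) admR]) auto
      then show ?thesis
        by (simp add: p_def pair_norm_def)
    next
      case False
      then have "arg2 x y \<tau> = push \<eta>2 b2 (norm y) y"
        by (simp add: arg2_def pair_norm_def beta)
      then have "\<forall>t\<in>{0..1}. min t \<eta>2 * b2 \<le> arg2 x y \<tau> t"
        using push_cone[of \<eta>2 b2 y] B.eta pos n2 by auto
      then obtain t where "t \<in> {0..1}" "b2 < T2 (arg2 x y \<tau>) (arg1 x y \<tau>) t"
        using leaves2 adm beta by metis
      then have "1 < norm (image2 x y \<tau>)"
        unfolding image2_def beta using pos by (intro B.norm_rescaled_greater[OF radii_pos(1) admR(2,1)]) auto
      then show ?thesis
        by (simp add: p_def pair_norm_def)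
    qed
    with fp \<open>\<tau> = 1\<close> show False
      by (simp add: clamp01_def min_def max_def split: if_splits)
  qed
  ultimately have p1: "p = 1"
    using fp \<tau> by (simp add: clamp01_def min_def max_def split: if_splits)
  have uncut: "cut v = v" if "norm v \<le> 1" for v :: "real \<Rightarrow>\<^sub>C real"
  proof (rule bcontfun_eqI)
    fix t
    have "v t \<le> 1"
      using bcontfun_abs_le_norm[of v t] that by linarith
    then show "cut v t = v t"
      by simp
  qed
  have x: "x = image1 x y \<tau>" and y: "y = image2 x y \<tau>"
    using fx fy uncut[of "image1 x y \<tau>"] uncut[of "image2 x y \<tau>"] p1 by (simp_all add: p_def pair_norm_def)
  have Pxy: "pair_norm x y = 1"
    using p1 x y by (simp add: p_def)
  define u v where "u = apply_bcontfun (arg1 x y \<tau>)" and "v = apply_bcontfun (arg2 x y \<tau>)"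
  have arg1: "arg1 x y \<tau> = push \<eta>1 (side1 \<tau>) 1 (A.rescaled (side1 \<tau>) (arg1 x y \<tau>) (arg2 x y \<tau>))"
    unfolding image1_def[symmetric] x[symmetric] by (simp add: arg1_def Pxy)
  have arg2: "arg2 x y \<tau> = push \<eta>2 (side2 \<tau>) 1 (B.rescaled (side2 \<tau>) (arg2 x y \<tau>) (arg1 x y \<tau>))"
    unfolding image2_def[symmetric] y[symmetric] by (simp add: arg2_def Pxy)
  have u: "u t = T1 u v t" if "t \<in> {0..1}" for t
    using A.push_rescaled[OF radii_pos(1) admR b(5) that] by (simp add: u_def v_def arg1[symmetric])
  have v: "v t = T2 v u t" if "t \<in> {0..1}" for t
    using B.push_rescaled[OF radii_pos(1) admR(2,1) b(6) that] by (simp add: u_def v_def arg2[symmetric])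
  have "\<exists>t\<in>{0..1}. u t \<noteq> 0 \<or> v t \<noteq> 0"
  proof (rule ccontr)
    assume "\<not> ?thesis"
    then have 0: "T1 u v t = 0" "T2 v u t = 0" if "t \<in> {0..1}" for t
      using u v that by auto
    have "image1 x y \<tau> = 0"
      by (intro bcontfun_eqI) (simp add: image1_def A.rescaled_apply[OF radii_pos(1) admR] 0 flip: u_def v_def)
    moreover have "image2 x y \<tau> = 0"
      by (intro bcontfun_eqI) (simp add: image2_def B.rescaled_apply[OF radii_pos(1) admR(2,1)] 0 flip: u_def v_def)
    ultimately show False
      using p1 by (simp add: p_def pair_norm_def)
  qed
  with u v admR show thesis
    by (intro that[of u v]) (auto simp: u_def v_def)
qed

end

section \<open>Nontrivial monotone solutions of the boundary value problem\<close>

context hammerstein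
begin

lemma cone_operator_slope_op: "cone_operator \<eta> slope_op"
proof
  fix R :: real assume "R > 0"
  then show "\<exists>L\<ge>0. \<forall>x y. \<forall>t\<in>{0..1}. \<forall>t'\<in>{0..1}. admissible R x \<longrightarrow> admissible R y
        \<longrightarrow> \<bar>slope_op x y t - slope_op x y t'\<bar> \<le> L * \<bar>t - t'\<bar>"
    using slope_op_lipschitz by metis
qed (use eta_pos eta_less_1 slope_op_nonneg slope_op_cone slope_op_uniform_limit in auto)

text \<open>
A fixed slope determines a component of the solution, namely its primitive.
\<close>

lemma fixed_point_profile:
  assumes "R > 0" and x: "admissible R x" and y: "admissible R y"
    and fixed: "\<forall>t\<in>{0..1}. x t = slope_op x y t"
  defines "u \<equiv> green_int (source x y)"
  shows "\<And>t. t \<in> {0..1} \<Longrightarrow> D u t = x t" and "C1 u"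
    and "\<And>t. t \<in> {0..1} \<Longrightarrow> u t = integral {0..t} x"
    and "\<And>t. t \<in> {0..1} \<Longrightarrow> 0 \<le> u t" and "mono_on {0..1} u"
    and "\<And>t. t \<in> {0..1} \<Longrightarrow> has_bochner_integral unit_leb (\<lambda>s. green \<eta> \<alpha> t s * source x y s) (u t)"
proof -
  note int = source_integrable[OF \<open>R > 0\<close> x y]
  have der: "(u has_vector_derivative x t) (at t within {0..1})" if "t \<in> {0..1}" for t
    using green_int_has_derivative[OF int that] bspec[OF fixed that]
    by (simp add: u_def slope_op_def has_real_derivative_iff_has_vector_derivative)
  then show Du: "D u t = x t" if "t \<in> {0..1}" for t
    unfolding D_def using that vector_derivative_within_cbox[of 0 1 t u "x t"] by simp
  show "C1 u"
    unfolding C1_def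
  proof
    show "\<forall>t\<in>{0..1}. u differentiable at t within {0..1}"
      using der[THEN differentiableI_vector] by blast
    have "continuous_on {0..1} x"
      using x by (simp add: admissible_def)
    then show "continuous_on {0..1} (D u)"
      by (rule continuous_on_eq) (simp add: Du)
  qed
  show u: "u t = integral {0..t} x" if "t \<in> {0..1}" for t
  proof -
    have "u t = integral {0..t} (slope_op x y)"
      by (simp add: u_def slope_op_def green_int_eq_integral[OF int that])
    also have "\<dots> = integral {0..t} x"
      using that fixed by (intro Henstock_Kurzweil_Integration.integral_cong) auto
    finally show ?thesis .
  qed
  then show "0 \<le> u t" if "t \<in> {0..1}" for t
    using admissible_integral(1)[OF x that] that by simp
  show "mono_on {0..1} u"
  proof (rule mono_onI)
    fix s t :: real assume st: "s \<in> {0..1}" "t \<in> {0..1}" "s \<le> t"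
    have "integral {0..s} x \<le> integral {0..t} x"
      using st x by (intro integral_subset_le admissible_integral(4)[OF x]) (auto simp: admissible_def)
    then show "u s \<le> u t"
      using st u by simp
  qed
  show "has_bochner_integral unit_leb (\<lambda>s. green \<eta> \<alpha> t s * source x y s) (u t)" if "t \<in> {0..1}" for t
    using integrable_green[OF int that] by (simp add: has_bochner_integral_iff u_def green_int_def)
qed

end

lemma norm_C_pos:
  assumes "continuous_on {0..1} w" "t \<in> {0..1}" "w t \<noteq> 0"
  shows "norm_C w > 0"
proof -
  have "bdd_above ((\<lambda>t. \<bar>w t\<bar>) ` {0..1})"
    by (intro bounded_imp_bdd_above compact_imp_bounded compact_continuous_image continuous_intros assms compact_Icc)
  then have "\<bar>w t\<bar> \<le> norm_C w"
    unfolding norm_C_def using assms(2) by (intro cSUP_upper)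
  then show ?thesis
    using assms(3) by simp
qed

lemma sup_ratio_lessE:
  assumes "sup_ratio f \<rho> X < ereal c"
  obtains q where "q < c" "\<forall>t u1 u2 v1 v2. (t, u1, u2, v1, v2) \<in> X \<longrightarrow> f t u1 u2 v1 v2 / \<rho> \<le> q"
proof -
  obtain q where q: "sup_ratio f \<rho> X < ereal q" "q < c"
    using ereal_dense2[OF assms] by auto
  have "f t u1 u2 v1 v2 / \<rho> \<le> q" if "(t, u1, u2, v1, v2) \<in> X" for t u1 u2 v1 v2
  proof -
    have "ereal (f t u1 u2 v1 v2 / \<rho>) \<le> sup_ratio f \<rho> X"
      unfolding sup_ratio_def using SUP_upper[OF that, of "\<lambda>(t, u1, u2, v1, v2). ereal (f t u1 u2 v1 v2 / \<rho>)"] by simp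
    also note q(1)
    finally show ?thesis by simp
  qed
  with q(2) that show thesis by blast
qed

lemma inf_ratio_greaterE:
  assumes "inf_ratio f \<rho> X > ereal c"
  obtains q where "c < q" "\<forall>t u1 u2 v1 v2. (t, u1, u2, v1, v2) \<in> X \<longrightarrow> q \<le> f t u1 u2 v1 v2 / \<rho>"
proof -
  obtain q where q: "ereal q < inf_ratio f \<rho> X" "c < q"
    using ereal_dense2[OF assms] by auto
  have "q \<le> f t u1 u2 v1 v2 / \<rho>" if "(t, u1, u2, v1, v2) \<in> X" for t u1 u2 v1 v2
  proof -
    note q(1)
    also have "inf_ratio f \<rho> X \<le> ereal (f t u1 u2 v1 v2 / \<rho>)"
      unfolding inf_ratio_def using INF_lower[OF that, of "\<lambda>(t, u1, u2, v1, v2). ereal (f t u1 u2 v1 v2 / \<rho>)"] by simp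
    finally show ?thesis by simp
  qed
  with q(2) that show thesis by blast
qed

lemma Linfty_Caratheodory_swap:
  assumes "Linfty_Caratheodory f"
  shows "Linfty_Caratheodory (\<lambda>t u1 u2 v1 v2. f t v1 v2 u1 u2)"
  unfolding Linfty_Caratheodory_def
proof (intro conjI allI impI)
  have "AE t in unit_leb. continuous_on ({0..} \<times> {0..} \<times> {0..} \<times> {0..}) (\<lambda>(u1, u2, v1, v2). f t u1 u2 v1 v2)"
    using assms by (simp add: Linfty_Caratheodory_def)
  then show "AE t in unit_leb. continuous_on ({0..} \<times> {0..} \<times> {0..} \<times> {0..}) (\<lambda>(u1, u2, v1, v2). f t v1 v2 u1 u2)"
  proof eventually_elim
    case (elim t)
    have "continuous_on ({0..} \<times> {0..} \<times> {0..} \<times> {0..})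
        (\<lambda>w::real \<times> real \<times> real \<times> real. case (fst (snd (snd w)), snd (snd (snd w)), fst w, fst (snd w)) of (u1, u2, v1, v2) \<Rightarrow> f t u1 u2 v1 v2)"
      by (rule continuous_on_compose2[OF elim]) (auto intro!: continuous_intros)
    then show ?case
      by (simp add: case_prod_beta)
  qed
next
  fix r :: real assume "r > 0"
  then obtain \<phi> where \<phi>: "Linfty \<phi>" "AE t in unit_leb. \<forall>u1\<in>{0..r}. \<forall>u2\<in>{0..r}. \<forall>v1\<in>{0..r}. \<forall>v2\<in>{0..r}. f t u1 u2 v1 v2 \<le> \<phi> t"
    using assms unfolding Linfty_Caratheodory_def by meson
  have "AE t in unit_leb. \<forall>u1\<in>{0..r}. \<forall>u2\<in>{0..r}. \<forall>v1\<in>{0..r}. \<forall>v2\<in>{0..r}. f t v1 v2 u1 u2 \<le> \<phi> t"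
    using \<phi>(2) by eventually_elim blast
  with \<phi>(1) show "\<exists>\<phi>. Linfty \<phi> \<and> (AE t in unit_leb. \<forall>u1\<in>{0..r}. \<forall>u2\<in>{0..r}. \<forall>v1\<in>{0..r}. \<forall>v2\<in>{0..r}. f t v1 v2 u1 u2 \<le> \<phi> t)"
    by blast
qed (use assms in \<open>auto simp: Linfty_Caratheodory_def\<close>)

theorem theorem4p3:
  fixes \<eta>1 \<alpha>1 \<eta>2 \<alpha>2 :: real
    and f1 f2 :: "real \<Rightarrow> real \<Rightarrow> real \<Rightarrow> real \<Rightarrow> real \<Rightarrow> real"
    and g1 g2 :: "real \<Rightarrow> real"
  assumes "0 < \<eta>1" "\<eta>1 < 1" "1 < \<alpha>1" "\<alpha>1 < 1 / \<eta>1"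
    and "0 < \<eta>2" "\<eta>2 < 1" "1 < \<alpha>2" "\<alpha>2 < 1 / \<eta>2"
    and "\<And>t u1 u2 v1 v2. \<lbrakk>t \<in> {0..1}; u1 \<ge> 0; u2 \<ge> 0; v1 \<ge> 0; v2 \<ge> 0\<rbrakk> \<Longrightarrow> f1 t u1 u2 v1 v2 \<ge> 0"
    and "\<And>t u1 u2 v1 v2. \<lbrakk>t \<in> {0..1}; u1 \<ge> 0; u2 \<ge> 0; v1 \<ge> 0; v2 \<ge> 0\<rbrakk> \<Longrightarrow> f2 t u1 u2 v1 v2 \<ge> 0"
    and "Linfty_Caratheodory f1" "Linfty_Caratheodory f2"
    and "integrable unit_leb g1" "AE t in unit_leb. g1 t \<ge> 0"
    and "integrable unit_leb g2" "AE t in unit_leb. g2 t \<ge> 0"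
    and "(LINT s|lebesgue_on {\<eta>1/\<alpha>1..\<eta>1}. (1 + \<alpha>1) / (1 - \<alpha>1 * \<eta>1) * s * (1 - s) * g1 s) > 0"
    and "(LINT s|lebesgue_on {\<eta>1/\<alpha>1..\<eta>1}. (1 - s) / (1 - \<alpha>1 * \<eta>1) * g1 s) > 0"
    and "(LINT s|lebesgue_on {\<eta>2/\<alpha>2..\<eta>2}. (1 + \<alpha>2) / (1 - \<alpha>2 * \<eta>2) * s * (1 - s) * g2 s) > 0"
    and "(LINT s|lebesgue_on {\<eta>2/\<alpha>2..\<eta>2}. (1 - s) / (1 - \<alpha>2 * \<eta>2) * g2 s) > 0"
    and "(\<exists>\<rho>1>0. \<exists>\<rho>2>0. \<exists>r1>0. \<exists>r2>0.
            \<rho>1 / c_const \<eta>1 \<alpha>1 < r1 \<and> \<rho>2 / c_const \<eta>2 \<alpha>2 < r2 \<and>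
            cond_I0 \<eta>1 \<alpha>1 g1 f1 \<eta>2 \<alpha>2 g2 f2 \<rho>1 \<rho>2 \<and>
            cond_I1 \<eta>1 \<alpha>1 g1 f1 \<eta>2 \<alpha>2 g2 f2 r1 r2) \<or>
         (\<exists>\<rho>1>0. \<exists>\<rho>2>0. \<exists>r1>0. \<exists>r2>0.
            \<rho>1 < r1 \<and> \<rho>2 < r2 \<and>
            cond_I1 \<eta>1 \<alpha>1 g1 f1 \<eta>2 \<alpha>2 g2 f2 \<rho>1 \<rho>2 \<and>
            cond_I0 \<eta>1 \<alpha>1 g1 f1 \<eta>2 \<alpha>2 g2 f2 r1 r2)"
  shows "\<exists>u v. solution \<eta>1 \<alpha>1 g1 f1 \<eta>2 \<alpha>2 g2 f2 u v \<and> norm_pair u v \<noteq> 0 \<and>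
           (\<forall>t\<in>{0..1}. u t \<ge> 0 \<and> v t \<ge> 0) \<and> mono_on {0..1} u \<and> mono_on {0..1} v"
proof -
  \<comment> \<open>The second equation with its own component listed first.\<close>
  define f2' where "f2' t u1 u2 v1 v2 = f2 t v1 v2 u1 u2" for t u1 u2 v1 v2
  obtain a1 a2 b1 b2 where pos: "a1 > 0" "a2 > 0" "b1 > 0" "b2 > 0"
    and I1: "cond_I1 \<eta>1 \<alpha>1 g1 f1 \<eta>2 \<alpha>2 g2 f2 a1 a2" and I0: "cond_I0 \<eta>1 \<alpha>1 g1 f1 \<eta>2 \<alpha>2 g2 f2 b1 b2"
    using assms(21) by blast
  interpret H1: hammerstein \<eta>1 \<alpha>1 g1 f1
    by unfold_locales (use assms in \<open>auto simp: field_simps\<close>)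
  interpret H2: hammerstein \<eta>2 \<alpha>2 g2 f2'
    by unfold_locales
       (use assms Linfty_Caratheodory_swap[of f2] in \<open>auto simp: field_simps f2'_def[abs_def]\<close>)
  interpret A: cone_operator \<eta>1 H1.slope_op
    by (rule H1.cone_operator_slope_op)
  interpret B: cone_operator \<eta>2 H2.slope_op
    by (rule H2.cone_operator_slope_op)
  interpret cone_system \<eta>1 \<eta>2 H1.slope_op H2.slope_op a1 a2 b1 b2
  proof unfold_locales
    show "\<exists>\<theta><1. \<forall>x y. \<forall>t\<in>{0..1}. admissible a1 x \<longrightarrow> admissible a2 y \<longrightarrow> H1.slope_op x y t \<le> \<theta> * a1"
    proof -
      obtain q where q: "q < min (m_const \<eta>1 \<alpha>1 g1) (m_star \<eta>1 \<alpha>1 g1)"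
        "\<forall>t u1 u2 v1 v2. (t, u1, u2, v1, v2) \<in> {0..1} \<times> {0..a1} \<times> {0..a1} \<times> {0..a2} \<times> {0..a2} \<longrightarrow> f1 t u1 u2 v1 v2 / a1 \<le> q"
        by (rule sup_ratio_lessE[OF I1[unfolded cond_I1_def, THEN conjunct1]])
      show ?thesis
        by (rule H1.slope_op_contracts_box[of a1 a2 q, OF pos(1,2)]) (use q in \<open>auto\<close>)
    qed
    show "\<exists>\<theta><1. \<forall>y x. \<forall>t\<in>{0..1}. admissible a2 y \<longrightarrow> admissible a1 x \<longrightarrow> H2.slope_op y x t \<le> \<theta> * a2"
    proof -
      obtain q where q: "q < min (m_const \<eta>2 \<alpha>2 g2) (m_star \<eta>2 \<alpha>2 g2)"
        "\<forall>t u1 u2 v1 v2. (t, u1, u2, v1, v2) \<in> {0..1} \<times> {0..a1} \<times> {0..a1} \<times> {0..a2} \<times> {0..a2} \<longrightarrow> f2 t u1 u2 v1 v2 / a2 \<le> q"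
        by (rule sup_ratio_lessE[OF I1[unfolded cond_I1_def, THEN conjunct2]])
      show ?thesis
        by (rule H2.slope_op_contracts_box[of a2 a1 q, OF pos(2,1)]) (use q in \<open>auto simp: f2'_def\<close>)
    qed
    show "\<exists>t\<in>{0..1}. b1 < H1.slope_op x y t"
      if "admissible b1 x" "admissible b2 y" "\<forall>t\<in>{0..1}. min t \<eta>1 * b1 \<le> x t" for x y
    proof -
      obtain q where q: "M_const \<eta>1 \<alpha>1 g1 < q"
        "\<forall>t u1 u2 v1 v2. (t, u1, u2, v1, v2) \<in> {\<eta>1/\<alpha>1..\<eta>1} \<times> {c_const \<eta>1 \<alpha>1 * b1..b1} \<times> {0..b1} \<times> {0..b2} \<times> {0..b2}
            \<longrightarrow> q \<le> f1 t u1 u2 v1 v2 / b1"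
        by (rule inf_ratio_greaterE[OF I0[unfolded cond_I0_def, THEN conjunct1]])
      show ?thesis
        by (rule H1.slope_op_leaves_box[OF pos(3,4) q(1) _ assms(17) that(1,2)])
           (use that(3) q(2) in auto)
    qed
    show "\<exists>t\<in>{0..1}. b2 < H2.slope_op y x t"
      if "admissible b2 y" "admissible b1 x" "\<forall>t\<in>{0..1}. min t \<eta>2 * b2 \<le> y t" for x y
    proof -
      obtain q where q: "M_const \<eta>2 \<alpha>2 g2 < q"
        "\<forall>t u1 u2 v1 v2. (t, u1, u2, v1, v2) \<in> {\<eta>2/\<alpha>2..\<eta>2} \<times> {0..b1} \<times> {0..b1} \<times> {c_const \<eta>2 \<alpha>2 * b2..b2} \<times> {0..b2}
            \<longrightarrow> q \<le> f2 t u1 u2 v1 v2 / b2"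
        by (rule inf_ratio_greaterE[OF I0[unfolded cond_I0_def, THEN conjunct2, THEN conjunct2, THEN conjunct1]])
      show ?thesis
        by (rule H2.slope_op_leaves_box[OF pos(4,3) q(1) _ assms(19) that(1,2)])
           (use that(3) q(2) in \<open>auto simp: f2'_def\<close>)
    qed
  qed (use pos in auto)
  obtain x y where x: "admissible outer x" and y: "admissible outer y"
    and fx: "\<forall>t\<in>{0..1}. x t = H1.slope_op x y t" and fy: "\<forall>t\<in>{0..1}. y t = H2.slope_op y x t"
    and nontrivial: "\<exists>t\<in>{0..1}. x t \<noteq> 0 \<or> y t \<noteq> 0"
    using nontrivial_fixed_point by blast
  define u v where "u = H1.green_int (H1.source x y)" and "v = H2.green_int (H2.source y x)"
  note U = H1.fixed_point_profile[OF radii_pos(1) x y fx, folded u_def]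
  note V = H2.fixed_point_profile[OF radii_pos(1) y x fy, folded v_def]
  have "has_bochner_integral unit_leb
          (\<lambda>s. green \<eta>1 \<alpha>1 t s * g1 s * f1 s (u s) (D u s) (v s) (D v s)) (u t)" if "t \<in> {0..1}" for t
    using U(6)[OF that]
    by (rule has_bochner_integral_cong[THEN iffD1, rotated 3])
       (auto simp: H1.source_def nemytskii_def U(1,3) V(1,3))
  moreover have "has_bochner_integral unit_leb
          (\<lambda>s. green \<eta>2 \<alpha>2 t s * g2 s * f2 s (u s) (D u s) (v s) (D v s)) (v t)" if "t \<in> {0..1}" for t
    using V(6)[OF that]
    by (rule has_bochner_integral_cong[THEN iffD1, rotated 3])
       (auto simp: H2.source_def nemytskii_def f2'_def U(1,3) V(1,3))
  ultimately have "solution \<eta>1 \<alpha>1 g1 f1 \<eta>2 \<alpha>2 g2 f2 u v"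
    using x y U(1,2,4) V(1,2,4) by (auto simp: solution_def admissible_def)
  moreover have "norm_pair u v > 0"
  proof -
    obtain t where t: "t \<in> {0..1}" "D u t \<noteq> 0 \<or> D v t \<noteq> 0"
      using nontrivial U(1) V(1) by auto
    have "continuous_on {0..1} (D u)" "continuous_on {0..1} (D v)"
      using U(2) V(2) by (auto simp: C1_def)
    then have "norm_C (D u) > 0 \<or> norm_C (D v) > 0"
      using t norm_C_pos by blast
    then show ?thesis
      by (auto simp: norm_pair_def norm_C1_def less_max_iff_disj)
  qed
  ultimately show ?thesis
    using U(4,5) V(4,5) by (intro exI[of _ u] exI[of _ v]) auto
qed

end
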